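(* There exist negative Latin-square-type partial difference sets with the following parameters and ambient groups: (1) a $(16384,5418,1762,1806)$-PDS in $\mathbb{F}_{2^6}^+\times\mathbb{Z}_4^4$; (2) a $(262144,87210,28898,29070)$-PDS in $\mathbb{Z}_4^4\times\mathbb{F}_{2^{10}}^+$; (3) a $(4194304,1397418,465122,465806)$-PDS in $\mathbb{F}_{2^{10}}^+\times\mathbb{Z}_8^4$; (4) a $(67108864,22366890,7452898,7455630)$-PDS in $\mathbb{Z}_8^4\times\mathbb{F}_{2^{14}}^+$.
   Context: All groups are finite and written additively. $\mathbb{F}_q^+$ denotes the additive group of the finite field $\mathbb{F}_q$ with $q$ elements, and $\mathbb{Z}_m=\mathbb{Z}/m\mathbb{Z}$. A subset $D$ of size $k$ of a finite group $G$ of order $v$ is a $(v,k,\lambda,\mu)$ partial difference set (PDS) if the multiset of differences $\{d_1-d_2 : d_1,d_2\in D,\ d_1\neq d_2\}$ contains each non-identity element of $D$ exactly $\lambda$ times and each non-identity element of $G$ not in $D$ exactly $\mu$ times. A PDS has negative Latin-square-type parameters (is of negative Latin-square type) if its parameters have the form $(v,k,\lambda,\mu)=(n^2,\ r(n+1),\ -n+r^2+3r,\ r^2+r)$ for some positive integers $n,r$. *)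

theory Defs
  imports "HOL-Analysis.Analysis" "HOL-Library.Numeral_Type" "HOL-Library.Multiset"
begin

text \<open>
  Groups are types of class \<open>group_add\<close> and \<open>finite\<close>. In particular, for a numeral \<open>m > 1\<close> the
  type \<open>m\<close> of \<open>HOL-Library.Numeral_Type\<close> is the ring of integers modulo \<open>m\<close>, so that the type
  \<open>4 ^ 4\<close> with componentwise addition is the group $\mathbb{Z}_4^4$, and \<open>8 ^ 4\<close> is
  $\mathbb{Z}_8^4$. The product of types carries componentwise addition.
\<close>

definition diff_mset :: "'g::{group_add,finite} set \<Rightarrow> 'g multiset" where
  "diff_mset D = image_mset (\<lambda>(x, y). x - y) (mset_set {(x, y). x \<in> D \<and> y \<in> D \<and> x \<noteq> y})"

definition partial_difference_set ::
  "'g::{group_add,finite} set \<Rightarrow> nat \<Rightarrow> nat \<Rightarrow> nat \<Rightarrow> nat \<Rightarrow> bool" where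
  "partial_difference_set D v k l m \<longleftrightarrow>
     CARD('g) = v \<and> card D = k \<and>
     (\<forall>g. g \<noteq> 0 \<longrightarrow> g \<in> D \<longrightarrow> count (diff_mset D) g = l) \<and>
     (\<forall>g. g \<noteq> 0 \<longrightarrow> g \<notin> D \<longrightarrow> count (diff_mset D) g = m)"

text \<open>The third parameter is compared in \<open>int\<close> because subtraction on \<open>nat\<close> truncates.\<close>

definition neg_latin_square_params :: "nat \<Rightarrow> nat \<Rightarrow> nat \<Rightarrow> nat \<Rightarrow> bool" where
  "neg_latin_square_params v k l m \<longleftrightarrow>
     (\<exists>n r :: nat. n > 0 \<and> r > 0 \<and> v = n\<^sup>2 \<and> k = r * (n + 1) \<and>
        int l = - int n + (int r)\<^sup>2 + 3 * int r \<and> m = r\<^sup>2 + r)"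

definition neg_latin_square_pds ::
  "'g::{group_add,finite} set \<Rightarrow> nat \<Rightarrow> nat \<Rightarrow> nat \<Rightarrow> nat \<Rightarrow> bool" where
  "neg_latin_square_pds D v k l m \<longleftrightarrow>
     partial_difference_set D v k l m \<and> neg_latin_square_params v k l m"

end

theory Submission
  imports Defs
begin

text \<open>
  Call a function \<open>F\<close> on a finite abelian group \<open>G\<close> of order $n^2$ cubic for the integer \<open>n\<close> if it is even,
  vanishes at $0$, takes cube roots of unity elsewhere, and satisfies $F * F = n \overline F$ and
  $F * \overline F = n^2 \delta_0 - 1$; then its three level sets form an amorphic association
  scheme of Latin square ($n > 0$) or negative Latin square ($n < 0$) type. If \<open>F\<close> is cubic on \<open>G\<close>
  for \<open>m\<close> and \<open>H\<close> is cubic on \<open>G'\<close> for $-2m$, then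
  $\{(x, y) : x \neq 0 \wedge (y = 0 \vee F(x) = H(y))\}$ is a partial difference set of negative Latin
  square type: its indicator is a combination of constants, delta functions, $F \otimes \overline H$
  and the conjugate of the latter, and all convolutions of these are known.

  On a field of order $m^2$ with $m = 2^s$, \<open>s\<close> odd, the lines through $0$ over the subfield of
  order \<open>m\<close> form a spread of $m + 1 \equiv 0 \pmod 3$ lines, and spreading the cube roots of unity
  evenly over the lines gives a cubic function for $n = m$. On $\mathbb{Z}_4^4$ and
  $\mathbb{Z}_8^4$, viewed as the Galois rings of rank $4$ with their Teichmueller group of order
  $15$, there are cubic functions for $n = -16$ and $n = -64$ which are invariant under integer units
  and are multiplied by $\omega$ under a generator of the Teichmueller group. This symmetry
  leaves few Fourier coefficients to be checked; they all have the form $n \omega^i$.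
\<close>

section \<open>Convolutions and cubic functions\<close>

definition conv ::
  "('g::{ab_group_add,finite} \<Rightarrow> complex) \<Rightarrow> ('g \<Rightarrow> complex) \<Rightarrow> 'g \<Rightarrow> complex" where
  "conv f h g = (\<Sum>x\<in>UNIV. f x * h (g - x))"

definition tensor :: "('a \<Rightarrow> complex) \<Rightarrow> ('b \<Rightarrow> complex) \<Rightarrow> 'a \<times> 'b \<Rightarrow> complex" where
  "tensor f h z = f (fst z) * h (snd z)"

lemma conv_commute: "conv f h g = conv h f g"
  unfolding conv_def
  by (rule sum.reindex_bij_witness[of _ "\<lambda>x. g - x" "\<lambda>x. g - x"]) (auto simp: mult.commute)

lemma conv_add_left: "conv (\<lambda>x. f x + f' x) h g = conv f h g + conv f' h g"
  by (simp add: conv_def algebra_simps sum.distrib)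

lemma conv_add_right: "conv f (\<lambda>x. h x + h' x) g = conv f h g + conv f h' g"
  by (simp add: conv_def algebra_simps sum.distrib)

lemma conv_cmult_left: "conv (\<lambda>x. c * f x) h g = c * conv f h g"
  by (simp add: conv_def sum_distrib_left mult.assoc)

lemma conv_cmult_right: "conv f (\<lambda>x. c * h x) g = c * conv f h g"
  by (simp add: conv_def sum_distrib_left mult.left_commute)

lemma conv_cnj: "conv (\<lambda>x. cnj (f x)) (\<lambda>x. cnj (h x)) g = cnj (conv f h g)"
  by (simp add: conv_def)

lemma conv_const: "conv (\<lambda>_. c) f g = c * sum f UNIV"
proof -
  have "(\<Sum>x\<in>UNIV. f (g - x)) = sum f UNIV"
    by (rule sum.reindex_bij_witness[of _ "\<lambda>x. g - x" "\<lambda>x. g - x"]) auto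
  thus ?thesis by (simp add: conv_def flip: sum_distrib_left)
qed

lemma conv_delta: "conv (\<lambda>x. if x = 0 then c else 0) f g = c * f g"
proof -
  have "conv (\<lambda>x. if x = 0 then c else 0) f g = (\<Sum>x\<in>UNIV. if x = g - g then c * f g else 0)"
    unfolding conv_def by (intro sum.cong) auto
  thus ?thesis by simp
qed

lemma conv_tensor:
  "conv (tensor f f') (tensor h h') g = conv f h (fst g) * conv f' h' (snd g)"
proof -
  have "conv f h (fst g) * conv f' h' (snd g) =
      (\<Sum>x\<in>UNIV. \<Sum>y\<in>UNIV. f x * h (fst g - x) * (f' y * h' (snd g - y)))"
    by (simp add: conv_def sum_product)
  also have "\<dots> = (\<Sum>z\<in>UNIV \<times> UNIV. f (fst z) * h (fst g - fst z) * (f' (snd z) * h' (snd g - snd z)))"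
    by (simp add: sum.cartesian_product case_prod_beta)
  finally show ?thesis
    by (simp add: conv_def tensor_def mult_ac)
qed

lemma sum_conv: "sum (conv f h) UNIV = sum f UNIV * sum h UNIV"
proof -
  have "sum (conv f h) UNIV = (\<Sum>x\<in>UNIV. f x * (\<Sum>g\<in>UNIV. h (g - x)))"
    unfolding conv_def by (subst sum.swap) (simp add: sum_distrib_left)
  also have "(\<lambda>x. \<Sum>g\<in>UNIV. h (g - x)) = (\<lambda>x. sum h UNIV)"
    by (rule ext, rule sum.reindex_bij_witness[of _ "\<lambda>g. g + x" "\<lambda>g. g - x" for x]) auto
  finally show ?thesis by (simp add: sum_distrib_right)
qed

definition cubic_function :: "int \<Rightarrow> ('g::{ab_group_add,finite} \<Rightarrow> complex) \<Rightarrow> bool" where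
  "cubic_function n F \<longleftrightarrow>
     F 0 = 0 \<and> (\<forall>x. x \<noteq> 0 \<longrightarrow> F x ^ 3 = 1) \<and> (\<forall>x. F (- x) = F x) \<and>
     (\<forall>g. conv F F g = of_int n * cnj (F g)) \<and>
     (\<forall>g. conv F (\<lambda>x. cnj (F x)) g = (if g = 0 then of_int (n\<^sup>2) else 0) - 1)"

lemma cube_root_unity_cnj:
  fixes z :: complex
  assumes "z ^ 3 = 1"
  shows "z * cnj z = 1" "cnj z = z\<^sup>2"
proof -
  have "norm z ^ 3 = 1" using assms by (metis norm_one norm_power)
  hence "norm z = 1"
    using power_eq_imp_eq_base[of "norm z" 3 1] by simp
  thus 1: "z * cnj z = 1" by (simp add: complex_norm_square[symmetric])
  have "z * z\<^sup>2 = 1" using assms by (simp add: power3_eq_cube power2_eq_square mult.assoc)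
  hence "cnj z * (z * z\<^sup>2) = cnj z" by simp
  moreover have "cnj z * (z * z\<^sup>2) = z * cnj z * z\<^sup>2" by (simp add: mult_ac)
  ultimately show "cnj z = z\<^sup>2" using 1 by simp
qed

text \<open>The two nontrivial cube roots of unity are the roots of z^2 + z + 1. The test
  \<open>z = 1\<close> thus becomes linear in \<open>z\<close> and its conjugate.\<close>

lemma cube_root_unity_cases:
  fixes z :: complex
  assumes "z ^ 3 = 1"
  shows "z + cnj z = (if z = 1 then 2 else -1)"
proof (cases "z = 1")
  case False
  have "(z - 1) * (z\<^sup>2 + z + 1) = z ^ 3 - 1"
    by (simp add: power3_eq_cube power2_eq_square algebra_simps)
  hence "z\<^sup>2 + z + 1 = 0" using assms False by simp
  hence "z + z\<^sup>2 = -1" by (metis add.commute add_eq_0_iff)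
  thus ?thesis using False cube_root_unity_cnj(2)[OF assms] by simp
qed simp

context
  fixes F :: "'g::{ab_group_add,finite} \<Rightarrow> complex" and n :: int
  assumes F: "cubic_function n F"
begin

lemma cubic_function_simps:
  "F 0 = 0" "x \<noteq> 0 \<Longrightarrow> F x ^ 3 = 1" "F (- x) = F x"
  "conv F F g = of_int n * cnj (F g)"
  "conv F (\<lambda>x. cnj (F x)) g = (if g = 0 then of_int (n\<^sup>2) else 0) - 1"
  using F by (auto simp: cubic_function_def)

lemma cubic_function_mult_cnj: "F x * cnj (F x) = (if x = 0 then 0 else 1)"
  using cubic_function_simps(1,2) cube_root_unity_cnj(1) by auto

text \<open>At 0 the autocorrelation counts the nonzero elements, because \<open>F\<close> is even
  and has modulus 1 there; the defining equation gives n^2 - 1.\<close>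

lemma cubic_function_card: "int CARD('g) = n\<^sup>2"
proof -
  have "conv F (\<lambda>x. cnj (F x)) 0 = (\<Sum>x\<in>(UNIV::'g set). 1 - (if x = 0 then 1 else 0))"
    unfolding conv_def using cubic_function_simps(3) cubic_function_mult_cnj
    by (intro sum.cong refl) simp
  also have "\<dots> = of_nat CARD('g) - 1" by (simp add: sum_subtractf)
  finally have "of_int (int CARD('g)) = (of_int (n\<^sup>2) :: complex)"
    by (simp add: cubic_function_simps(5))
  thus ?thesis by (simp only: of_int_eq_iff)
qed

text \<open>Summing the autocorrelation over the group gives |sum F|^2 = n^2 - |G|, which is
  0.\<close>

lemma cubic_function_sum: "sum F UNIV = 0"
proof -
  have "sum F UNIV * cnj (sum F UNIV) = sum (conv F (\<lambda>x. cnj (F x))) UNIV"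
    by (simp add: sum_conv)
  also have "\<dots> = of_int (n\<^sup>2) - of_nat CARD('g)"
    by (simp add: cubic_function_simps(5) sum_subtractf)
  also have "\<dots> = 0"
    using cubic_function_card by (metis cancel_comm_monoid_add_class.diff_cancel of_int_of_nat_eq)
  finally show ?thesis by (simp flip: cnj_sum)
qed

text \<open>The constant 1 annihilates a function of sum zero, so only the delta part acts, as the
  scalar \<open>c\<close>.\<close>

lemma conv_affine_delta_cubic:
  "conv (\<lambda>x. (if x = 0 then c else 0) + 1) F g = c * F g"
  by (subst conv_add_left) (simp add: conv_delta conv_const cubic_function_sum)

lemma conv_affine_delta_cnj:
  "conv (\<lambda>x. (if x = 0 then c else 0) + 1) (\<lambda>x. cnj (F x)) g = c * cnj (F g)"
  by (subst conv_add_left) (simp add: conv_delta conv_const cubic_function_sum flip: cnj_sum)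

lemma conv_affine_delta_self:
  "conv (\<lambda>x. (if x = 0 then c else 0) + 1) (\<lambda>x. (if x = 0 then c else 0) + 1) (g::'g) =
     (if g = 0 then c\<^sup>2 else 0) + 2 * c + of_int (n\<^sup>2)"
proof -
  have "(\<Sum>x\<in>(UNIV::'g set). (if x = 0 then c else 0) + (1::complex)) = c + of_int (int CARD('g))"
    by (simp add: sum.distrib)
  thus ?thesis
    by (subst conv_add_left)
       (simp only: conv_delta conv_const cubic_function_card, simp add: algebra_simps power2_eq_square)
qed

end

lemma count_diff_mset:
  fixes D :: "'g::{ab_group_add,finite} set"
  assumes "g \<noteq> 0" and sym: "\<And>x. - x \<in> D \<longleftrightarrow> x \<in> D"
  shows "of_nat (count (diff_mset D) g) = conv (\<lambda>x. of_bool (x \<in> D)) (\<lambda>x. of_bool (x \<in> D)) g"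
proof -
  have "count (diff_mset D) g = card {z \<in> {(x, y). x \<in> D \<and> y \<in> D \<and> x \<noteq> y}. (\<lambda>(x,y). x - y) z = g}"
    unfolding diff_mset_def by (simp add: count_image_mset sum.If_cases vimage_def Int_def conj_commute)
  also have "\<dots> = card {x. x \<in> D \<and> x - g \<in> D}"
    by (rule bij_betw_same_card[of fst], rule bij_betwI[of _ _ _ "\<lambda>x. (x, x - g)"]) 
       (use assms(1) in \<open>auto simp: algebra_simps\<close>)
  \<comment> \<open>Symmetry of \<open>D\<close> turns the correlation into a convolution.\<close>
  also have "{x. x \<in> D \<and> x - g \<in> D} = {x. x \<in> D \<and> g - x \<in> D}"
    using sym by (metis minus_diff_eq)
  also have "of_nat (card \<dots>) = (\<Sum>x\<in>UNIV. if x \<in> D \<and> g - x \<in> D then 1 else (0::complex))"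
    by (simp add: sum.If_cases)
  also have "\<dots> = conv (\<lambda>x. of_bool (x \<in> D)) (\<lambda>x. of_bool (x \<in> D)) g"
    unfolding conv_def by (intro sum.cong) auto
  finally show ?thesis .
qed

section \<open>The product construction\<close>

theorem product_pds:
  fixes F :: "'a::{ab_group_add,finite} \<Rightarrow> complex" and H :: "'b::{ab_group_add,finite} \<Rightarrow> complex"
  assumes F: "cubic_function m F" and H: "cubic_function (- 2 * m) H"
    and v: "int v = 4 * m ^ 4" and k: "3 * int k = 4 * m ^ 4 - 2 * m\<^sup>2 - 2"
    and l: "9 * int l = 4 * m ^ 4 - 8 * m\<^sup>2 - 14" and mu: "9 * int mu = 4 * m ^ 4 - 2 * m\<^sup>2 - 2"
  shows "partial_difference_set {(x, y). x \<noteq> 0 \<and> (y = 0 \<or> F x = H y)} v k l mu"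
proof -
  define D where "D = {(x, y). x \<noteq> 0 \<and> (y = 0 \<or> F x = H y)}"
  define f :: "'a \<times> 'b \<Rightarrow> complex" where "f = (\<lambda>z. of_bool (z \<in> D))"
  \<comment> \<open>\<open>P\<close> is 0 where x = 0, 3 where only y = 0, and 1 elsewhere; adding
    \<open>Q\<close> and \<open>Q'\<close> and dividing by 3 yields the indicator of
    \<open>D\<close>.\<close>
  define P where "P = tensor (\<lambda>x::'a. (if x = 0 then - 1 else 0) + 1) (\<lambda>y::'b. (if y = 0 then 2 else 0) + 1)"
  define Q where "Q = tensor F (\<lambda>y. cnj (H y))"
  define Q' where "Q' = tensor (\<lambda>x. cnj (F x)) H"
  define d :: "'a \<times> 'b \<Rightarrow> complex" where "d = (\<lambda>z. of_bool (fst z = 0))"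
  define d' :: "'a \<times> 'b \<Rightarrow> complex" where "d' = (\<lambda>z. of_bool (snd z = 0))"
  let ?m = "of_int m :: complex"
  have m4: "of_int ((- 2 * m)\<^sup>2) = 4 * ?m\<^sup>2" by (simp add: power_mult_distrib)
  note Fs = cubic_function_simps[OF F] and Hs = cubic_function_simps[OF H]
  have QQ: "Q z + Q' z = (if fst z = 0 \<or> snd z = 0 then 0 else if z \<in> D then 2 else - 1)" for z
  proof (cases "fst z = 0 \<or> snd z = 0")
    case False
    \<comment> \<open>\<open>t\<close> is a cube root of unity, equal to 1 exactly when F(x) = H(y),
      and the sum in question is \<open>t + cnj t\<close>.\<close>
    define t where "t = F (fst z) * cnj (H (snd z))"
    have t3: "t ^ 3 = 1"
      using False Fs(2)[of "fst z"] Hs(2)[of "snd z"]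
      by (simp add: t_def power_mult_distrib flip: complex_cnj_power)
    have "t = 1 \<longleftrightarrow> F (fst z) = H (snd z)"
    proof
      assume "t = 1"
      hence "t * H (snd z) = H (snd z)" by simp
      thus "F (fst z) = H (snd z)"
        using False cubic_function_mult_cnj[OF H, of "snd z"]
        by (simp add: t_def mult_ac)
    next
      assume "F (fst z) = H (snd z)"
      thus "t = 1" using False cubic_function_mult_cnj[OF H, of "snd z"] by (simp add: t_def)
    qed
    moreover have "Q z + Q' z = t + cnj t"
      by (simp add: Q_def Q'_def tensor_def t_def)
    ultimately show ?thesis
      using False cube_root_unity_cases[OF t3] by (auto simp: D_def)
  qed (auto simp: Q_def Q'_def tensor_def Fs(1) Hs(1))
  have f: "f z = 1 / 3 * (P z + (Q z + Q' z))" for z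
    unfolding QQ using Fs(1) by (auto simp: f_def D_def P_def tensor_def)
  have PP: "conv P P z = (d z - 2 + ?m\<^sup>2) * (4 * d' z + 4 + 4 * ?m\<^sup>2)" for z
    unfolding P_def conv_tensor conv_affine_delta_self[OF F] conv_affine_delta_self[OF H] m4
    by (simp add: d_def d'_def)
  \<comment> \<open>The scalars -1 and 2 of the two factors of \<open>P\<close> multiply to
    -2.\<close>
  have PQ: "conv P Q z = - 2 * Q z" "conv P Q' z = - 2 * Q' z" for z
    unfolding P_def Q_def Q'_def conv_tensor conv_affine_delta_cubic[OF F] conv_affine_delta_cubic[OF H]
      conv_affine_delta_cnj[OF F] conv_affine_delta_cnj[OF H] by (simp_all add: tensor_def)
  have QP: "conv Q P z = - 2 * Q z" "conv Q' P z = - 2 * Q' z" for z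
    by (subst conv_commute, rule PQ)+
  \<comment> \<open>Each square is the same multiple of the other function, so
    \<open>conv f f\<close> involves \<open>Q\<close> and \<open>Q'\<close> only through
    \<open>Q + Q'\<close>, which depends on membership in \<open>D\<close> and on the axes.\<close>
  have sq: "conv Q Q z = - 2 * ?m\<^sup>2 * Q' z" "conv Q' Q' z = - 2 * ?m\<^sup>2 * Q z" for z
    unfolding Q_def Q'_def conv_tensor conv_cnj Fs(4) Hs(4) by (simp_all add: tensor_def power2_eq_square)
  have QQ': "conv Q Q' z = (d z * ?m\<^sup>2 - 1) * (4 * d' z * ?m\<^sup>2 - 1)" for z
    unfolding Q_def Q'_def conv_tensor conv_commute[of "\<lambda>y. cnj (H y)" H] Fs(5) Hs(5) m4
    by (simp add: d_def d'_def)
  have Q'Q: "conv Q' Q z = (d z * ?m\<^sup>2 - 1) * (4 * d' z * ?m\<^sup>2 - 1)" for z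
    by (subst conv_commute, rule QQ')
  have ff: "9 * conv f f z = (d z - 2 + ?m\<^sup>2) * (4 * d' z + 4 + 4 * ?m\<^sup>2)
      - (4 + 2 * ?m\<^sup>2) * (Q z + Q' z) + 2 * ((d z * ?m\<^sup>2 - 1) * (4 * d' z * ?m\<^sup>2 - 1))" for z
  proof -
    have "conv f f z = 1 / 3 * (1 / 3 * conv (\<lambda>z. P z + (Q z + Q' z)) (\<lambda>z. P z + (Q z + Q' z)) z)"
      unfolding f[abs_def] conv_cmult_left conv_cmult_right ..
    also have "9 * \<dots> = conv (\<lambda>z. P z + (Q z + Q' z)) (\<lambda>z. P z + (Q z + Q' z)) z" by simp
    also have "\<dots> = (d z - 2 + ?m\<^sup>2) * (4 * d' z + 4 + 4 * ?m\<^sup>2)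
      - (4 + 2 * ?m\<^sup>2) * (Q z + Q' z) + 2 * ((d z * ?m\<^sup>2 - 1) * (4 * d' z * ?m\<^sup>2 - 1))"
      unfolding conv_add_left conv_add_right PP PQ QP sq QQ' Q'Q by (simp add: algebra_simps)
    finally show ?thesis .
  qed
  have symD: "- z \<in> D \<longleftrightarrow> z \<in> D" for z
    by (cases z) (auto simp: D_def Fs(3) Hs(3))
  have cnt: "of_int (9 * int (count (diff_mset D) g)) = 9 * conv f f g" if "g \<noteq> 0" for g
    using count_diff_mset[OF that symD] by (simp add: f_def)
  have "CARD('a \<times> 'b) = v"
  proof -
    have "int CARD('a \<times> 'b) = int v"
      using cubic_function_card[OF F] cubic_function_card[OF H] v
      by (simp add: power_mult_distrib)
    thus ?thesis by (simp only: of_nat_eq_iff)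
  qed
  moreover have "card D = k"
  proof -
    \<comment> \<open>As \<open>D\<close> is symmetric, the convolution at 0 counts \<open>D\<close>
      itself.\<close>
    have "conv f f 0 = (\<Sum>x\<in>UNIV. if x \<in> D then 1 else 0)"
      unfolding conv_def f_def by (intro sum.cong) (auto simp: symD)
    also have "\<dots> = of_nat (card D)" by (simp add: sum.If_cases)
    finally have "of_int (9 * int (card D)) = 9 * conv f f 0" by simp
    also have "\<dots> = of_int (12 * m ^ 4 - 6 * m\<^sup>2 - 6)"
      unfolding ff QQ by (simp add: d_def d'_def algebra_simps)
    finally have "9 * int (card D) = 12 * m ^ 4 - 6 * m\<^sup>2 - 6" by (simp only: of_int_eq_iff)
    thus ?thesis using k by linarith
  qed
  moreover have "count (diff_mset D) g = l" if "g \<noteq> 0" "g \<in> D" for g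
  proof -
    have "fst g \<noteq> 0" using that by (auto simp: D_def)
    have "of_int (9 * int (count (diff_mset D) g)) = (of_int (4 * m ^ 4 - 8 * m\<^sup>2 - 14) :: complex)"
      unfolding cnt[OF that(1)] ff QQ using that(2) \<open>fst g \<noteq> 0\<close>
      by (simp add: d_def d'_def algebra_simps)
    hence "9 * int (count (diff_mset D) g) = 4 * m ^ 4 - 8 * m\<^sup>2 - 14" by (simp only: of_int_eq_iff)
    thus ?thesis using l by linarith
  qed
  moreover have "count (diff_mset D) g = mu" if "g \<noteq> 0" "g \<notin> D" for g
  proof -
    \<comment> \<open>A nonzero point outside \<open>D\<close> lies on the axis x = 0 or off both
      axes; the ratio -2 of the two parameters makes both cases give the same count.\<close>
    have "fst g = 0 \<and> snd g \<noteq> 0 \<or> fst g \<noteq> 0 \<and> snd g \<noteq> 0"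
      using that by (cases g) (auto simp: D_def zero_prod_def)
    hence "of_int (9 * int (count (diff_mset D) g)) = (of_int (4 * m ^ 4 - 2 * m\<^sup>2 - 2) :: complex)"
      unfolding cnt[OF that(1)] ff QQ using that(2)
      by (auto simp add: d_def d'_def algebra_simps)
    hence "9 * int (count (diff_mset D) g) = 4 * m ^ 4 - 2 * m\<^sup>2 - 2" by (simp only: of_int_eq_iff)
    thus ?thesis using mu by linarith
  qed
  ultimately show ?thesis
    unfolding D_def[symmetric] partial_difference_set_def by blast
qed

section \<open>Spreads and fields of characteristic two\<close>

text \<open>Two different components are complementary subgroups, so their indicators convolve to
  the constant 1, while a component convolved with itself gives \<open>m\<close> times its
  indicator. The constants cancel because the weights \<open>r z\<close> sum to 0.\<close>

lemma spread_cubic_function: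
  fixes L :: "'i \<Rightarrow> 'g::{ab_group_add,finite} set"
  assumes Z: "finite Z" "card Z = m + 1" and card: "CARD('g) = m\<^sup>2"
    and L0: "\<And>z. z \<in> Z \<Longrightarrow> 0 \<in> L z"
    and Ldiff: "\<And>z x y. z \<in> Z \<Longrightarrow> x \<in> L z \<Longrightarrow> y \<in> L z \<Longrightarrow> x - y \<in> L z"
    and Lcard: "\<And>z. z \<in> Z \<Longrightarrow> card (L z) = m"
    and Lint: "\<And>z z' x. z \<in> Z \<Longrightarrow> z' \<in> Z \<Longrightarrow> z \<noteq> z' \<Longrightarrow> x \<in> L z \<Longrightarrow> x \<in> L z' \<Longrightarrow> x = 0"
    and r3: "\<And>z. z \<in> Z \<Longrightarrow> r z ^ 3 = 1" and r0: "sum r Z = 0"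
  shows "cubic_function (int m) (\<lambda>x. \<Sum>z\<in>Z. r z * of_bool (x \<in> L z))"
proof -
  define F where "F = (\<lambda>x. \<Sum>z\<in>Z. r z * of_bool (x \<in> L z))"
  have neg: "- x \<in> L z \<longleftrightarrow> x \<in> L z" if "z \<in> Z" for x z
    using Ldiff[OF that L0[OF that], of x] Ldiff[OF that L0[OF that], of "- x"] by auto
  have Ladd: "x + y \<in> L z" if "z \<in> Z" "x \<in> L z" "y \<in> L z" for x y z
    using Ldiff[of z x "- y"] that neg[of z y] by simp
  have "m > 0" using L0 Lcard Z by (metis card_gt_0_iff card.empty empty_iff finite all_not_in_conv
      add_is_0 one_neq_zero)
  \<comment> \<open>The m + 1 components have m - 1 nonzero elements each, disjointly, and m^2 - 1
    is the number of all nonzero elements.\<close>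
  have cover: "\<exists>z\<in>Z. x \<in> L z" if "x \<noteq> 0" for x
  proof -
    have "card (\<Union>z\<in>Z. L z - {0}) = (\<Sum>z\<in>Z. card (L z - {0}))"
      using Z(1) Lint by (intro card_UN_disjoint) auto
    also have "\<dots> = (\<Sum>z\<in>Z. m - 1)"
      using L0 Lcard by (intro sum.cong) (auto simp: card_Diff_singleton)
    also have "\<dots> = card (UNIV - {0 :: 'g})"
      using card Z \<open>m > 0\<close> by (simp add: card_Diff_singleton algebra_simps power2_eq_square diff_mult_distrib2)
    finally have "(\<Union>z\<in>Z. L z - {0}) = UNIV - {0}"
      by (intro card_subset_eq) auto
    thus ?thesis using that by blast
  qed
  have unique: "{z \<in> Z. x \<in> L z} = {z}" if "x \<noteq> 0" "z \<in> Z" "x \<in> L z" for x z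
    using that Lint by blast
  \<comment> \<open>The constant 1 is split off on the diagonal too, so that in the double sum it
    contributes just the product of the two weight sums.\<close>
  have conv_L: "conv (\<lambda>x. of_bool (x \<in> L z)) (\<lambda>x. of_bool (x \<in> L z')) g =
      1 + (if z = z' then of_nat m * of_bool (g \<in> L z) - 1 else 0)" if zz: "z \<in> Z" "z' \<in> Z" for z z' g
  proof -
    have "conv (\<lambda>x. of_bool (x \<in> L z)) (\<lambda>x. of_bool (x \<in> L z')) g =
        (\<Sum>x\<in>UNIV. if x \<in> L z \<and> g - x \<in> L z' then 1 else 0)"
      unfolding conv_def by (intro sum.cong) auto
    also have "\<dots> = of_nat (card {x. x \<in> L z \<and> g - x \<in> L z'})"
      by (simp add: sum.If_cases)
    also have "\<dots> = 1 + (if z = z' then of_nat m * of_bool (g \<in> L z) - 1 else 0)"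
    proof (cases "z = z'")
      case True
      have "{x. x \<in> L z \<and> g - x \<in> L z} = (if g \<in> L z then L z else {})"
        using Ladd[of z] Ldiff[of z] zz by (auto, metis add.commute diff_add_cancel)
      thus ?thesis using True Lcard zz by simp
    next
      case False
      have inj: "inj_on (\<lambda>(x, y). x + y) (L z \<times> L z')"
      proof (rule inj_onI, clarify)
        fix x y x' y' assume *: "x \<in> L z" "y \<in> L z'" "x' \<in> L z" "y' \<in> L z'" "x + y = x' + y'"
        have "x - x' = y' - y" using *(5) by (simp add: algebra_simps)
        hence "x - x' = 0" using Lint[OF zz False, of "x - x'"] Ldiff zz * by metis
        thus "x = x' \<and> y = y'" using *(5) by simp
      qed
      \<comment> \<open>Addition is injective on the product of two components, which has as many
        elements as the group; so each \<open>g\<close> decomposes in exactly one way.\<close>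
      have "card ((\<lambda>(x, y). x + y) ` (L z \<times> L z')) = CARD('g)"
        using card_image[OF inj] Lcard zz card by (simp add: card_cartesian_product power2_eq_square)
      hence "(\<lambda>(x, y). x + y) ` (L z \<times> L z') = UNIV"
        by (intro card_subset_eq) auto
      hence "g \<in> (\<lambda>(x, y). x + y) ` (L z \<times> L z')" by simp
      then obtain a b where ab: "a \<in> L z" "b \<in> L z'" "g = a + b" by auto
      have "{x. x \<in> L z \<and> g - x \<in> L z'} = {a}"
      proof (intro equalityI subsetI)
        fix x assume "x \<in> {x. x \<in> L z \<and> g - x \<in> L z'}"
        hence "(x, g - x) = (a, b)" using inj ab by (intro inj_onD[OF inj]) auto
        thus "x \<in> {a}" by simp
      qed (use ab in auto)
      thus ?thesis using False by simp
    qed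
    finally show ?thesis .
  qed
  have conv_sum: "conv (\<lambda>x. \<Sum>z\<in>Z. a z * of_bool (x \<in> L z)) (\<lambda>x. \<Sum>z\<in>Z. b z * of_bool (x \<in> L z)) g =
      sum a Z * sum b Z + (\<Sum>z\<in>Z. a z * b z * (of_nat m * of_bool (g \<in> L z) - 1))" for a b g
  proof -
    have "conv (\<lambda>x. \<Sum>z\<in>Z. a z * of_bool (x \<in> L z)) (\<lambda>x. \<Sum>z\<in>Z. b z * of_bool (x \<in> L z)) g =
      (\<Sum>x\<in>UNIV. \<Sum>z\<in>Z. \<Sum>z'\<in>Z. a z * b z' * (of_bool (x \<in> L z) * of_bool (g - x \<in> L z')))"
      by (simp add: conv_def sum_product mult_ac)
    also have "\<dots> = (\<Sum>z\<in>Z. \<Sum>z'\<in>Z. \<Sum>x\<in>UNIV. a z * b z' * (of_bool (x \<in> L z) * of_bool (g - x \<in> L z')))"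
      by (subst sum.swap, intro sum.cong refl, rule sum.swap)
    also have "\<dots> = (\<Sum>z\<in>Z. \<Sum>z'\<in>Z. a z * b z' *
        conv (\<lambda>x. of_bool (x \<in> L z)) (\<lambda>x. of_bool (x \<in> L z')) g)"
      by (simp only: conv_def sum_distrib_left)
    also have "\<dots> = (\<Sum>z\<in>Z. \<Sum>z'\<in>Z. a z * b z' +
        (if z = z' then a z * b z * (of_nat m * of_bool (g \<in> L z) - 1) else 0))"
      by (intro sum.cong refl) (auto simp: conv_L algebra_simps)
    also have "\<dots> = sum a Z * sum b Z + (\<Sum>z\<in>Z. a z * b z * (of_nat m * of_bool (g \<in> L z) - 1))"
      using Z(1) by (simp add: sum.distrib sum_product)
    finally show ?thesis .
  qed
  have cnjF: "cnj (F x) = (\<Sum>z\<in>Z. cnj (r z) * of_bool (x \<in> L z))" for x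
    unfolding F_def cnj_sum by (intro sum.cong) (auto simp: of_bool_def)
  have cnj0: "(\<Sum>z\<in>Z. cnj (r z)) = 0" using r0 by (metis cnj_sum complex_cnj_zero)
  have sq: "r z * r z = cnj (r z)" "r z * cnj (r z) = 1" if "z \<in> Z" for z
    using cube_root_unity_cnj[OF r3[OF that]] by (simp_all add: power2_eq_square)
  have "F 0 = 0" using r0 L0 by (simp add: F_def)
  moreover have "F x ^ 3 = 1" if x: "x \<noteq> 0" for x
  proof -
    obtain z where z: "z \<in> Z" "x \<in> L z" using cover[OF x] by blast
    have "F x = (\<Sum>z\<in>{z\<in>Z. x \<in> L z}. r z)"
      unfolding F_def sum.inter_filter[OF Z(1)] by (intro sum.cong) auto
    thus ?thesis using unique[OF x z] r3[OF z(1)] by simp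
  qed
  moreover have "F (- x) = F x" for x
    unfolding F_def by (intro sum.cong) (auto simp: neg)
  moreover have "conv F F g = of_int (int m) * cnj (F g)" for g
  proof -
    have "conv F F g = (\<Sum>z\<in>Z. cnj (r z) * (of_nat m * of_bool (g \<in> L z) - 1))"
      unfolding F_def conv_sum r0 by (simp add: sq)
    also have "\<dots> = of_nat m * cnj (F g) - (\<Sum>z\<in>Z. cnj (r z))"
      unfolding cnjF by (simp add: algebra_simps sum_subtractf sum_distrib_left)
    finally show ?thesis by (simp add: cnj0)
  qed
  moreover have "conv F (\<lambda>x. cnj (F x)) g = (if g = 0 then of_int ((int m)\<^sup>2) else 0) - 1" for g
  proof -
    have "conv F (\<lambda>x. cnj (F x)) g = (\<Sum>z\<in>Z. of_nat m * of_bool (g \<in> L z) - 1)"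
      unfolding cnjF unfolding F_def conv_sum r0 by (simp add: sq)
    also have "\<dots> = of_nat m * of_nat (card {z\<in>Z. g \<in> L z}) - of_nat (m + 1)"
      using Z by (simp add: sum_subtractf sum.inter_filter[symmetric] of_bool_def flip: sum_distrib_left)
    also have "\<dots> = (if g = 0 then of_int ((int m)\<^sup>2) else 0) - 1"
    proof (cases "g = 0")
      case True
      hence "{z\<in>Z. g \<in> L z} = Z" using L0 by auto
      thus ?thesis using True Z by (simp add: algebra_simps power2_eq_square)
    next
      case False
      obtain z where z: "z \<in> Z" "g \<in> L z" using cover[OF False] by blast
      show ?thesis using unique[OF False z] False by simp
    qed
    finally show ?thesis .
  qed
  ultimately show ?thesis unfolding cubic_function_def F_def[symmetric] by blast
qed

definition \<omega> :: complex where "\<omega> = cis (2 * pi / 3)"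

lemma omega_cube: "\<omega> ^ 3 = 1"
  unfolding \<omega>_def Complex.DeMoivre by simp

lemma omega_neq_1: "\<omega> \<noteq> 1"
proof
  assume "\<omega> = 1"
  hence "Re \<omega> = 1" by simp
  thus False by (simp add: \<omega>_def cos_120)
qed

lemma omega_power_cube: "(\<omega> ^ k) ^ 3 = 1"
  by (metis omega_cube power_commutes power_mult mult.commute power_one)

section \<open>Fields of order 2^(2s) and their lines over the subfield of order 2^s\<close>

lemma finite_field_power_card:
  fixes x :: "'f::{field,finite}"
  shows "x ^ CARD('f) = x"
proof (cases "x = 0")
  case False
  have "(\<Prod>y\<in>UNIV - {0}. x * y) = (\<Prod>y\<in>UNIV - {0 :: 'f}. y)"
    by (rule prod.reindex_bij_witness[of _ "\<lambda>y. y / x" "\<lambda>y. x * y"]) (use False in auto)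
  hence "x ^ (CARD('f) - 1) * (\<Prod>y\<in>UNIV - {0 :: 'f}. y) = 1 * (\<Prod>y\<in>UNIV - {0 :: 'f}. y)"
    by (simp add: prod.distrib card_Diff_singleton)
  hence "x ^ (CARD('f) - 1) = 1" by (subst (asm) mult_cancel_right) auto
  thus ?thesis by (metis Suc_diff_1 mult.right_neutral power_Suc zero_less_card_finite)
qed simp

text \<open>Translation by 1 permutes the ring, and changes the sum of all elements by the order of
  the ring.\<close>

lemma of_nat_card_eq_0: "of_nat CARD('f) = (0 :: 'f::{comm_ring_1,finite})"
proof -
  have "(\<Sum>y\<in>UNIV. y + 1) = (\<Sum>y\<in>(UNIV :: 'f set). y)"
    by (rule sum.reindex_bij_witness[of _ "\<lambda>y. y - 1" "\<lambda>y. y + 1"]) auto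
  thus ?thesis by (simp add: sum.distrib)
qed

lemma binary_field_cubic_function:
  assumes card: "CARD('f::{field,finite}) = (2 ^ s)\<^sup>2" and "odd s"
  shows "\<exists>F :: 'f \<Rightarrow> complex. cubic_function (2 ^ s) F"
proof -
  define m :: nat where "m = 2 ^ s"
  have m: "CARD('f) = m\<^sup>2" "m > 0" and m2: "m \<ge> 2"
    using card odd_pos[OF \<open>odd s\<close>] self_le_power[of 2 s] by (simp_all add: m_def)
  have two: "(2 :: 'f) = 0"
    using of_nat_card_eq_0[where 'f = 'f] unfolding card by simp
  have frob: "(x + y) ^ (2 ^ k) = x ^ (2 ^ k) + (y :: 'f) ^ (2 ^ k)" for x y k
  proof (induction k)
    case (Suc k)
    have "(x + y) ^ (2 ^ Suc k) = ((x + y) ^ (2 ^ k))\<^sup>2" by (simp only: power_Suc2 power_mult)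
    also have "\<dots> = (x ^ (2 ^ k))\<^sup>2 + (y ^ (2 ^ k))\<^sup>2" by (simp add: Suc power2_sum two)
    finally show ?case by (simp only: power_Suc2 power_mult)
  qed simp
  have mm: "x ^ (m * m) = x" for x :: 'f
    using finite_field_power_card[of x] m by (simp add: power2_eq_square)
  \<comment> \<open>For x nonzero, x lies in \<open>L z\<close> iff x^(m-1) = z. So two nonzero
    elements share a set iff their ratio lies in the subfield of order \<open>m\<close>, and the
    occurring z satisfy z^(m+1) = x^(m^2-1) = 1.\<close>
  define L where "L = (\<lambda>z::'f. {x. x ^ m = z * x})"
  define Z where "Z = {z :: 'f. z ^ (m + 1) = 1}"
  have neg: "- x = x" for x :: 'f
    using two by (metis add_eq_0_iff mult_2 mult_zero_left)
  have L0: "0 \<in> L z" for z using m by (simp add: L_def)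
  have Ldiff: "x - y \<in> L z" if "x \<in> L z" "y \<in> L z" for x y z
  proof -
    have "x - y = x + y" using neg[of y] by (metis diff_conv_add_uminus)
    show ?thesis
      unfolding \<open>x - y = x + y\<close> using that frob[of x y s] by (simp add: L_def m_def distrib_left)
  qed
  have Lint: "x = 0" if "x \<in> L z" "x \<in> L z'" "z \<noteq> z'" for x z z'
    using that by (auto simp: L_def)
  have card_Z_le: "card Z \<le> m + 1"
  proof -
    let ?p = "monom 1 (m + 1) + [:- 1:] :: 'f poly"
    have deg: "degree ?p = m + 1"
      by (subst degree_add_eq_left) (auto simp: degree_monom_eq)
    hence "?p \<noteq> 0" by auto
    moreover have "Z = {z. poly ?p z = 0}" by (simp add: Z_def poly_monom)
    ultimately show ?thesis using card_poly_roots_bound[of ?p] deg by simp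
  qed
  have card_L_le: "card (L z) \<le> m" for z
  proof -
    let ?p = "monom 1 m + monom (- z) 1 :: 'f poly"
    have deg: "degree ?p = m"
      using m2 degree_monom_le[of "- z" 1] by (subst degree_add_eq_left) (auto simp: degree_monom_eq)
    hence "?p \<noteq> 0" using m2 by auto
    moreover have "L z = {x. poly ?p x = 0}" by (simp add: L_def poly_monom)
    ultimately show ?thesis using card_poly_roots_bound[of ?p] deg by simp
  qed
  have UN: "(\<Union>z\<in>Z. L z - {0}) = UNIV - {0}"
  proof (intro equalityI subsetI)
    fix x :: 'f assume x: "x \<in> UNIV - {0}"
    have "x ^ (m - 1) * x = x ^ m" using m by (intro power_minus_mult) simp
    hence "x \<in> L (x ^ (m - 1))" by (simp add: L_def)
    moreover have "x ^ (m - 1) \<in> Z"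
    proof -
      have "x * (x ^ (m - 1)) ^ (m + 1) = x ^ Suc ((m - 1) * (m + 1))"
        by (simp only: power_Suc power_mult)
      also have "Suc ((m - 1) * (m + 1)) = m * m"
        using m2 by (simp add: algebra_simps diff_mult_distrib)
      finally show ?thesis using x mm[of x] by (simp add: Z_def)
    qed
    ultimately show "x \<in> (\<Union>z\<in>Z. L z - {0})" using x by blast
  qed auto
  have sub1: "card (L z - {0}) = card (L z) - 1" for z using L0 by (simp add: card_Diff_singleton)
  have sum_L: "(\<Sum>z\<in>Z. card (L z) - 1) = (m + 1) * (m - 1)"
  proof -
    have "(\<Sum>z\<in>Z. card (L z - {0})) = card (\<Union>z\<in>Z. L z - {0})"
      using Lint by (intro card_UN_disjoint[symmetric]) auto
    also have "\<dots> = m * m - 1" unfolding UN using m by (simp add: card_Diff_singleton power2_eq_square)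
    also have "\<dots> = (m + 1) * (m - 1)" using m2 by (simp add: algebra_simps diff_mult_distrib2)
    finally show ?thesis by (simp add: sub1)
  qed
  \<comment> \<open>Root counting bounds |Z| by m + 1 and each |L z| by m. Covering all nonzero
    elements requires both bounds to be attained.\<close>
  have card_Z: "card Z = m + 1"
  proof (rule antisym[OF card_Z_le])
    have "(m + 1) * (m - 1) \<le> (\<Sum>z\<in>Z. m - 1)"
      unfolding sum_L[symmetric] using card_L_le by (intro sum_mono diff_le_mono) auto
    hence "(m + 1) * (m - 1) \<le> card Z * (m - 1)" by (simp only: sum_constant of_nat_id)
    moreover have "m - 1 > 0" using m2 by simp
    ultimately show "m + 1 \<le> card Z" by (metis mult_le_cancel2)
  qed
  have card_L: "card (L z) = m" if "z \<in> Z" for z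
  proof (rule ccontr)
    assume "card (L z) \<noteq> m"
    hence "card (L z) - 1 < m - 1" using card_L_le[of z] m2 by linarith
    hence "(\<Sum>z\<in>Z. card (L z) - 1) < (\<Sum>z\<in>Z. m - 1)"
      using that card_L_le by (intro sum_strict_mono_ex1) (auto intro!: diff_le_mono)
    thus False by (simp only: sum_L sum_constant card_Z of_nat_id less_irrefl)
  qed
  \<comment> \<open>Any numbering of the lines serves, since only the sum of the weights \<omega>^0,
    ..., \<omega>^m has to vanish.\<close>
  obtain h where h: "bij_betw h Z {0..<m + 1}"
    using ex_bij_betw_finite_nat[of Z] card_Z by auto
  \<comment> \<open>This is where oddness of \<open>s\<close> enters: 2^s is then -1 modulo
    3.\<close>
  have "3 dvd m + 1"
  proof -
    obtain k where "s = 2 * k + 1" using \<open>odd s\<close> by (auto elim: oddE)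
    hence "m = 2 * 4 ^ k" by (simp add: m_def power_mult)
    moreover have "(4 :: nat) ^ k mod 3 = 1" by (induction k) (auto simp: mod_mult_right_eq[symmetric])
    ultimately have "(m + 1) mod 3 = 0" by presburger
    thus ?thesis by auto
  qed
  hence "\<omega> ^ (m + 1) = 1" by (metis dvdE omega_cube power_mult power_one)
  have "(\<Sum>z\<in>Z. \<omega> ^ h z) = (\<Sum>i\<in>{0..<m + 1}. \<omega> ^ i)"
    by (rule sum.reindex_bij_betw[OF h])
  also have "\<dots> = 0"
    using geometric_sum[OF omega_neq_1, of "m + 1"] \<open>\<omega> ^ (m + 1) = 1\<close> by (simp add: atLeast0LessThan)
  finally have "cubic_function (int m) (\<lambda>x. \<Sum>z\<in>Z. \<omega> ^ h z * of_bool (x \<in> L z))"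
    using m card_Z card_L L0 Ldiff Lint omega_power_cube by (intro spread_cubic_function) auto
  thus ?thesis by (auto simp: m_def)
qed

section \<open>Fourier transforms\<close>

text \<open>Translating the variable by \<open>h\<close> multiplies the sum by \<psi>(h), which is
  not 1.\<close>

lemma sum_character_eq_0:
  fixes \<psi> :: "'g::{ab_group_add,finite} \<Rightarrow> complex"
  assumes "\<And>x y. \<psi> (x + y) = \<psi> x * \<psi> y" and "\<psi> h \<noteq> 1"
  shows "(\<Sum>x\<in>UNIV. \<psi> x) = 0"
proof -
  have "(\<Sum>x\<in>UNIV. \<psi> x) = (\<Sum>x\<in>UNIV. \<psi> (h + x))"
    by (rule sum.reindex_bij_witness[of _ "\<lambda>x. h + x" "\<lambda>x. x - h"]) (auto simp: algebra_simps)
  also have "\<dots> = \<psi> h * (\<Sum>x\<in>UNIV. \<psi> x)"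
    by (simp add: assms(1) sum_distrib_left)
  finally show ?thesis using assms(2) by simp
qed

text \<open>A symmetric nondegenerate bicharacter identifies the group with its dual, so that
  Fourier transforms live on the group itself.\<close>

locale self_dual_group =
  fixes e :: "'g::{ab_group_add,finite} \<Rightarrow> 'g \<Rightarrow> complex"
  assumes e_add: "e u (x + y) = e u x * e u y"
    and e_commute: "e u x = e x u"
    and norm_e: "norm (e u x) = 1"
    and e_nondegenerate: "x \<noteq> 0 \<Longrightarrow> \<exists>u. e u x \<noteq> 1"
begin

lemma e_zero: "e u 0 = 1" "e 0 u = 1"
proof -
  have "e u 0 * e u 0 = e u 0" using e_add[of u 0 0] by simp
  moreover have "e u 0 \<noteq> 0" using norm_e[of u 0] by auto
  ultimately show "e u 0 = 1" by simp
  thus "e 0 u = 1" by (simp add: e_commute)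
qed

lemma e_minus: "e u (- x) = cnj (e u x)"
proof -
  have "e u (- x) * e u x = 1" using e_add[of u "- x" x] by (simp add: e_zero)
  moreover have "e u x * cnj (e u x) = 1" using norm_e by (simp flip: complex_norm_square)
  ultimately show ?thesis by (metis mult.left_commute mult.right_neutral mult.commute)
qed

lemma sum_e: "(\<Sum>x\<in>UNIV. e u x) = (if u = 0 then of_nat CARD('g) else 0)"
proof (cases "u = 0")
  case False
  then obtain h where "e u h \<noteq> 1" using e_nondegenerate by (metis e_commute)
  thus ?thesis using sum_character_eq_0[of "e u" h] e_add False by simp
qed (simp add: e_zero)

definition fourier :: "('g \<Rightarrow> complex) \<Rightarrow> 'g \<Rightarrow> complex" where
  "fourier f u = (\<Sum>x\<in>UNIV. f x * e u x)"

lemma fourier_inject: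
  assumes "\<And>u. fourier f u = fourier h u"
  shows "f = h"
proof
  fix y
  \<comment> \<open>Fourier inversion, from orthogonality of the characters.\<close>
  have *: "(\<Sum>u\<in>UNIV. fourier f u * e u (- y)) = of_nat CARD('g) * f y" for f
  proof -
    have "(\<Sum>u\<in>UNIV. fourier f u * e u (- y)) = (\<Sum>u\<in>UNIV. \<Sum>x\<in>UNIV. f x * e (x - y) u)"
      by (simp add: fourier_def sum_distrib_right mult.assoc e_commute[of "_ - _"] flip: e_add)
    also have "\<dots> = (\<Sum>x\<in>UNIV. f x * (\<Sum>u\<in>UNIV. e (x - y) u))"
      by (subst sum.swap) (simp add: sum_distrib_left)
    also have "\<dots> = (\<Sum>x\<in>UNIV. if x = y then f x * of_nat CARD('g) else 0)"
      by (intro sum.cong refl) (simp add: sum_e)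
    finally show ?thesis by simp
  qed
  have "of_nat CARD('g) * f y = of_nat CARD('g) * h y"
    unfolding *[symmetric] assms ..
  thus "f y = h y" by simp
qed

lemma fourier_conv: "fourier (conv f h) u = fourier f u * fourier h u"
proof -
  have *: "conv (\<lambda>x. f x * e u x) (\<lambda>x. h x * e u x) g = conv f h g * e u g" for g
  proof -
    have "e u g = e u x * e u (g - x)" for x by (simp flip: e_add)
    thus ?thesis unfolding conv_def sum_distrib_right by (intro sum.cong) (simp_all add: mult_ac)
  qed
  have "fourier f u * fourier h u = sum (conv (\<lambda>x. f x * e u x) (\<lambda>x. h x * e u x)) UNIV"
    by (simp add: sum_conv fourier_def)
  thus ?thesis by (simp add: * fourier_def)
qed

text \<open>For even \<open>f\<close> the substitution of -x for x conjugates the character along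
  with the value.\<close>

lemma fourier_cnj:
  assumes "\<And>x. f (- x) = f x"
  shows "fourier (\<lambda>x. cnj (f x)) u = cnj (fourier f u)"
proof -
  have "cnj (fourier f u) = (\<Sum>x\<in>UNIV. cnj (f (- x)) * e u (- x))"
    by (simp add: fourier_def assms e_minus)
  also have "\<dots> = fourier (\<lambda>x. cnj (f x)) u"
    unfolding fourier_def by (rule sum.reindex_bij_witness[of _ uminus uminus]) auto
  finally show ?thesis ..
qed

text \<open>Off 0 the transform is n r with r^3 = 1. Its square n^2 r^2 is n times its conjugate,
  and its squared modulus is n^2, vanishing at 0; these are the transforms of the two right-hand
  sides in \<open>cubic_function\<close>.\<close>

lemma cubic_function_fourier:
  assumes card: "int CARD('g) = n\<^sup>2"
    and F: "F 0 = 0" "\<And>x. x \<noteq> 0 \<Longrightarrow> F x ^ 3 = 1" "\<And>x. F (- x) = F x"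
    and F0: "sum F UNIV = 0" and hat: "\<And>u. u \<noteq> 0 \<Longrightarrow> fourier F u ^ 3 = of_int n ^ 3"
  shows "cubic_function n F"
proof -
  have "n \<noteq> 0" using card by auto
  have root: "fourier F u = of_int n * r \<Longrightarrow> r ^ 3 = 1" if "u \<noteq> 0" for u r
    using hat[OF that] \<open>n \<noteq> 0\<close> by (simp add: power_mult_distrib)
  have hat0: "fourier F 0 = 0" using F0 by (simp add: fourier_def e_zero)
  have hats: "fourier F u * fourier F u = of_int n * cnj (fourier F u)"
    "fourier F u * cnj (fourier F u) = (if u = 0 then 0 else of_int (n\<^sup>2))" for u
  proof -
    define r where "r = fourier F u / of_int n"
    have r: "fourier F u = of_int n * r" using \<open>n \<noteq> 0\<close> by (simp add: r_def)
    have "r * cnj r = 1 \<and> cnj r = r\<^sup>2" if "u \<noteq> 0"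
      using cube_root_unity_cnj[OF root[OF that r]] by blast
    thus "fourier F u * fourier F u = of_int n * cnj (fourier F u)"
      "fourier F u * cnj (fourier F u) = (if u = 0 then 0 else of_int (n\<^sup>2))"
      using hat0 by (cases "u = 0"; simp add: r power2_eq_square)+
  qed
  have "conv F F = (\<lambda>g. of_int n * cnj (F g))"
  proof (rule fourier_inject)
    fix u
    have "fourier (\<lambda>g. of_int n * cnj (F g)) u = of_int n * fourier (\<lambda>g. cnj (F g)) u"
      by (simp add: fourier_def sum_distrib_left mult.assoc)
    thus "fourier (conv F F) u = fourier (\<lambda>g. of_int n * cnj (F g)) u"
      by (simp add: fourier_conv fourier_cnj F(3) hats)
  qed
  moreover have "conv F (\<lambda>x. cnj (F x)) = (\<lambda>g. (if g = 0 then of_int (n\<^sup>2) else 0) - 1)"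
  proof (rule fourier_inject)
    fix u
    have "fourier (\<lambda>g. (if g = 0 then of_int (n\<^sup>2) else 0) - 1) u =
        (\<Sum>g\<in>UNIV. (if g = 0 then of_int (n\<^sup>2) else 0) - e u g)"
      unfolding fourier_def by (intro sum.cong) (auto simp: e_zero algebra_simps)
    also have "\<dots> = of_int (n\<^sup>2) - (if u = 0 then of_int (int CARD('g)) else 0)"
      by (simp add: sum_subtractf sum_e)
    finally show "fourier (conv F (\<lambda>x. cnj (F x))) u =
        fourier (\<lambda>g. (if g = 0 then of_int (n\<^sup>2) else 0) - 1) u"
      by (simp add: fourier_conv fourier_cnj F(3) hats card)
  qed
  ultimately show ?thesis using F by (simp add: cubic_function_def)
qed

end

section \<open>Dyadic roots of unity\<close>

definition dyadic_root :: "nat \<Rightarrow> int \<Rightarrow> complex" where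
  "dyadic_root m t = cis (2 * pi * of_int t / 2 ^ m)"

lemma dyadic_root_add: "dyadic_root m (s + t) = dyadic_root m s * dyadic_root m t"
  by (simp add: dyadic_root_def cis_mult add_divide_distrib distrib_left)

lemma norm_dyadic_root [simp]: "norm (dyadic_root m t) = 1"
  by (simp add: dyadic_root_def)

lemma dyadic_root_0 [simp]: "dyadic_root m 0 = 1"
  by (simp add: dyadic_root_def)

lemma dyadic_root_eq_1_iff: "dyadic_root m t = 1 \<longleftrightarrow> 2 ^ m dvd t"
proof -
  have "dyadic_root m t = 1 \<longleftrightarrow> (\<exists>n::int. 2 * pi * of_int t / 2 ^ m = of_int (2 * n) * pi)"
    by (simp add: dyadic_root_def cis_conv_exp exp_eq_1)
  also have "\<dots> \<longleftrightarrow> (\<exists>n::int. real_of_int t = of_int (n * 2 ^ m))"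
    by (intro ex_cong1) (simp add: field_simps)
  also have "\<dots> \<longleftrightarrow> 2 ^ m dvd t"
    unfolding of_int_eq_iff dvd_def by (simp add: mult.commute)
  finally show ?thesis .
qed

lemma dyadic_root_cong: "2 ^ m dvd s - t \<Longrightarrow> dyadic_root m s = dyadic_root m t"
  using dyadic_root_add[of m "s - t" t] dyadic_root_eq_1_iff[of m "s - t"] by simp

lemma dyadic_root_mult_pow2: "j \<le> m \<Longrightarrow> dyadic_root m (2 ^ j * t) = dyadic_root (m - j) t"
  by (simp add: dyadic_root_def power_diff field_simps)

lemma dyadic_root_mult_nat: "dyadic_root m (int n * s) = dyadic_root m s ^ n"
  by (induction n) (simp_all add: distrib_right dyadic_root_add)

text \<open>Closed form of the Ramanujan sum of modulus 2^m, for m at least 1.\<close>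

definition ramanujan :: "nat \<Rightarrow> int \<Rightarrow> int" where
  "ramanujan m s = (if 2 ^ m dvd s then 2 ^ (m - 1) else if 2 ^ (m - 1) dvd s then - (2 ^ (m - 1)) else 0)"

lemma ramanujan_cong: "2 ^ m dvd s - t \<Longrightarrow> ramanujan m s = ramanujan m t"
proof -
  assume a: "2 ^ m dvd s - t"
  moreover have "(2::int) ^ (m - 1) dvd 2 ^ m" by (simp add: le_imp_power_dvd)
  ultimately have "2 ^ (m - 1) dvd s - t" by (metis dvd_trans)
  hence "2 ^ m dvd s \<longleftrightarrow> 2 ^ m dvd t" "2 ^ (m - 1) dvd s \<longleftrightarrow> 2 ^ (m - 1) dvd t"
    using a by (metis dvd_add_right_iff diff_add_cancel)+
  thus ?thesis by (simp only: ramanujan_def)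
qed

lemma ramanujan_mult_odd: "odd w \<Longrightarrow> ramanujan m (w * s) = ramanujan m s"
proof -
  assume "odd w"
  hence "2 ^ n dvd w * s \<longleftrightarrow> 2 ^ n dvd s" for n
    by (intro coprime_dvd_mult_right_iff) simp
  thus ?thesis by (simp only: ramanujan_def)
qed

definition odds :: "nat \<Rightarrow> int set" where
  "odds m = {w. odd w \<and> 0 \<le> w \<and> w < 2 ^ m}"

lemma sum_dyadic_root: "(\<Sum>w\<in>{0..<2 ^ m}. dyadic_root m (w * s)) = (if 2 ^ m dvd s then 2 ^ m else 0)"
proof -
  have "(\<Sum>w\<in>{0..<2 ^ m}. dyadic_root m (w * s)) = (\<Sum>n\<in>{..<2 ^ m}. dyadic_root m s ^ n)"
    by (rule sum.reindex_bij_witness[of _ int nat]) (auto simp: nat_less_iff simp flip: dyadic_root_mult_nat)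
  also have "\<dots> = (if 2 ^ m dvd s then 2 ^ m else 0)"
  proof (cases "2 ^ m dvd s")
    case True
    thus ?thesis using dyadic_root_eq_1_iff[of m s] by simp
  next
    case False
    hence "dyadic_root m s \<noteq> 1" by (simp add: dyadic_root_eq_1_iff)
    moreover have "dyadic_root m s ^ (2 ^ m) = 1"
      using dyadic_root_eq_1_iff[of m "int (2 ^ m) * s"] by (simp flip: dyadic_root_mult_nat)
    ultimately show ?thesis using False by (simp add: geometric_sum)
  qed
  finally show ?thesis .
qed

text \<open>The odd residues are all residues minus the even ones, and the even ones give the
  complete sum for the modulus 2^(m-1).\<close>

lemma sum_dyadic_root_odds:
  assumes "m \<ge> 1"
  shows "(\<Sum>w\<in>odds m. dyadic_root m (w * s)) = of_int (ramanujan m s)"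
proof -
  obtain l where m: "m = Suc l" using assms by (metis Suc_le_D One_nat_def)
  have split: "{0..<2 ^ m} = odds m \<union> (\<lambda>w. 2 * w) ` {0..<2 ^ l}"
    by (auto simp: odds_def m image_iff elim!: evenE)
  have "(\<Sum>w\<in>{0..<2 ^ m}. dyadic_root m (w * s)) =
      (\<Sum>w\<in>odds m. dyadic_root m (w * s)) + (\<Sum>w\<in>(\<lambda>w. 2 * w) ` {0..<2 ^ l}. dyadic_root m (w * s))"
    unfolding split by (rule sum.union_disjoint) (use split in \<open>auto simp: odds_def intro: finite_subset[of _ "{0..<2 ^ m}"]\<close>)
  also have "(\<Sum>w\<in>(\<lambda>w. 2 * w) ` {0..<2 ^ l}. dyadic_root m (w * s)) = (\<Sum>w\<in>{0..<2 ^ l}. dyadic_root l (w * s))"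
    using dyadic_root_mult_pow2[of 1 m] by (subst sum.reindex) (auto simp: inj_on_def m mult.assoc)
  finally have "(\<Sum>w\<in>odds m. dyadic_root m (w * s)) =
      (if 2 ^ m dvd s then 2 ^ m else 0) - (if 2 ^ l dvd s then 2 ^ l else 0)"
    unfolding sum_dyadic_root by simp
  moreover have "2 ^ l dvd s" if "2 ^ m dvd s"
    using that by (rule dvd_trans[rotated]) (simp add: m)
  ultimately show ?thesis by (simp add: ramanujan_def m)
qed

section \<open>An integer matrix of order 15 modulo 8\<close>

type_synonym quad = "int \<times> int \<times> int \<times> int"

fun dot :: "quad \<Rightarrow> quad \<Rightarrow> int" where
  "dot (a, b, c, d) (a', b', c', d') = a * a' + b * b' + c * c' + d * d'"

fun scale :: "int \<Rightarrow> quad \<Rightarrow> quad" where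
  "scale t (a, b, c, d) = (t * a, t * b, t * c, t * d)"

fun qdvd :: "int \<Rightarrow> quad \<Rightarrow> bool" where
  "qdvd n (a, b, c, d) \<longleftrightarrow> n dvd a \<and> n dvd b \<and> n dvd c \<and> n dvd d"

text \<open>The matrix is symmetric, hence self-adjoint for the dot product; modulo 2 it generates the field of order 16.\<close>

fun turn :: "quad \<Rightarrow> quad" where
  "turn (a, b, c, d) = (3 * a - c, - b - d, - a - 3 * c - d, - b - c - 2 * d)"

lemma dot_commute: "dot x y = dot y x"
  by (cases x; cases y) (simp add: mult.commute)

lemma dot_add: "dot x (y + z) = dot x y + dot x z"
  by (cases x; cases y; cases z) (simp add: algebra_simps)

lemma dot_diff: "dot x (y - z) = dot x y - dot x z"
  by (cases x; cases y; cases z) (simp add: algebra_simps)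

lemma dot_scale: "dot x (scale t y) = t * dot x y" "dot (scale t x) y = t * dot x y"
  by (cases x; cases y; simp add: algebra_simps)+

lemma dvd_dot: "qdvd n y \<Longrightarrow> n dvd dot x y"
  by (cases x; cases y) simp

lemma turn_diff: "turn (x - y) = turn x - turn y"
  by (cases x; cases y) (simp add: algebra_simps)

lemma turn_scale: "turn (scale t x) = scale t (turn x)"
  by (cases x) (simp add: algebra_simps)

lemma turn_pow_diff: "(turn ^^ i) (x - y) = (turn ^^ i) x - (turn ^^ i) y"
  by (induction i) (simp_all add: turn_diff)

lemma turn_pow_scale: "(turn ^^ i) (scale t x) = scale t ((turn ^^ i) x)"
  by (induction i) (simp_all add: turn_scale)

lemma dot_turn: "dot (turn x) y = dot x (turn y)"
  by (cases x; cases y) (simp add: algebra_simps)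

lemma dot_turn_pow: "dot ((turn ^^ i) x) y = dot x ((turn ^^ i) y)"
proof (induction i arbitrary: y)
  case (Suc i)
  have "(turn ^^ i) (turn y) = turn ((turn ^^ i) y)" by (simp add: funpow_swap1)
  thus ?case by (simp add: dot_turn Suc.IH)
qed simp

lemma qdvd_turn_pow: "qdvd n x \<Longrightarrow> qdvd n ((turn ^^ i) x)"
proof (induction i)
  case (Suc i)
  thus ?case by (cases "(turn ^^ i) x") simp
qed simp

lemma qdvd_add: "qdvd n x \<Longrightarrow> qdvd n y \<Longrightarrow> qdvd n (x + y)"
  by (cases x; cases y) simp

lemma qdvd_diff: "qdvd n x \<Longrightarrow> qdvd n y \<Longrightarrow> qdvd n (x - y)"
  by (cases x; cases y) simp

lemma qdvd_trans: "n dvd n' \<Longrightarrow> qdvd n' x \<Longrightarrow> qdvd n x"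
  by (cases x) (auto dest: dvd_trans)

lemma qdvd_scale_cancel: "n \<noteq> 0 \<Longrightarrow> qdvd (n * n') (scale n x) \<longleftrightarrow> qdvd n' x"
  by (cases x) simp

lemma turn_pow_15: "qdvd 8 ((turn ^^ 15) x - x)"
proof (cases x)
  case (fields a b c d)
  \<comment> \<open>The explicit fifth power, applied three times, keeps the expansion small; the
    congruence holds modulo 8 only.\<close>
  have "(turn ^^ 5) (a, b, c, d) = (298 * a - 19 * b - 132 * c - 40 * d,
      - 19 * a - 43 * b - 116 * c - 100 * d, - 132 * a - 116 * b - 534 * c - 351 * d,
      - 40 * a - 100 * b - 351 * c - 259 * d)" for a b c d
    by (simp add: eval_nat_numeral algebra_simps)
  moreover have "(turn ^^ (5 + 5 + 5)) x = (turn ^^ 5) ((turn ^^ 5) ((turn ^^ 5) x))"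
    by (simp only: funpow_add o_apply)
  hence "(turn ^^ 15) x = (turn ^^ 5) ((turn ^^ 5) ((turn ^^ 5) x))" by simp
  ultimately show ?thesis
    unfolding fields by (simp add: algebra_simps)
qed

lemma turn_pow_add_15: "qdvd 8 ((turn ^^ (n + 15)) x - (turn ^^ n) x)"
proof -
  have "(turn ^^ (n + 15)) x - (turn ^^ n) x = (turn ^^ n) ((turn ^^ 15) x - x)"
    by (simp add: funpow_add turn_pow_diff)
  thus ?thesis by (simp only: qdvd_turn_pow turn_pow_15)
qed

section \<open>Exact evaluation of the Fourier coefficients\<close>

definition triples :: "int list \<Rightarrow> (int \<times> int \<times> int) list" where
  "triples l = List.product l (List.product l l)"

text \<open>
  Exponents of \<open>\<omega>\<close> at the points $2^j (1, 2a, 2b, 2c)$ of $\mathbb{Z}_{2^k}^4$, where $m = k - j$ and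
  $(a, b, c)$ runs lexicographically through $\{0, \dots, 2^{m-1} - 1\}^3$; found by computer search.
\<close>

definition table :: "nat \<Rightarrow> ((int \<times> int \<times> int) \<times> nat) list" where
  "table m =
     (if m = 3 then zip (triples [0, 1, 2, 3])
       [0,0,0,1, 2,2,1,1, 1,2,1,0, 2,1,0,1, 1,0,0,1, 2,0,1,0, 2,2,2,2, 2,1,1,0,
        2,2,0,0, 0,0,0,2, 0,1,2,0, 1,0,0,1, 1,2,1,0, 2,0,2,2, 1,2,0,1, 0,2,0,1]
      else if m = 2 then zip (triples [0, 1]) [0,0, 0,1, 1,2, 2,0]
      else [((0, 0, 0), 0)])"

definition reps :: "nat \<Rightarrow> (int \<times> int \<times> int) set" where
  "reps m = fst ` set (table m)"

definition expo :: "nat \<Rightarrow> int \<times> int \<times> int \<Rightarrow> nat" where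
  "expo m y = the (map_of (table m) y)"

text \<open>Representatives of the vectors not divisible by 2, modulo 2^m, under powers of
  \<open>turn\<close> and odd integer factors, when (a, b, c) runs through
  \<open>reps m\<close>.\<close>

fun base :: "int \<times> int \<times> int \<Rightarrow> quad" where
  "base (a, b, c) = (1, 2 * a, 2 * b, 2 * c)"

definition valid_table :: "nat \<Rightarrow> bool" where
  "valid_table m \<longleftrightarrow> distinct (map fst (table m)) \<and> length (table m) = 8 ^ (m - 1) \<and>
     (\<forall>p \<in> set (table m). fst (fst p) \<in> {0..<2 ^ (m - 1)} \<and> fst (snd (fst p)) \<in> {0..<2 ^ (m - 1)} \<and>
        snd (snd (fst p)) \<in> {0..<2 ^ (m - 1)} \<and> snd p \<in> {0, 1, 2})"

lemma valid_table: "m \<in> {1, 2, 3} \<Longrightarrow> valid_table m"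
proof -
  have "valid_table 1" "valid_table 2" "valid_table 3" by code_simp+
  thus "m \<in> {1, 2, 3} \<Longrightarrow> valid_table m" by auto
qed

lemma sum_table:
  assumes "valid_table m"
  shows "(\<Sum>y\<in>reps m. h y (expo m y)) = (\<Sum>(y, r)\<leftarrow>table m. h y r)"
proof -
  have d: "distinct (map fst (table m))" using assms by (simp add: valid_table_def)
  have "(\<Sum>(y, r)\<leftarrow>table m. h y r) = (\<Sum>(y, r)\<in>set (table m). h y r)"
    using d by (intro sum_list_distinct_conv_sum_set) (simp add: distinct_map)
  also have "\<dots> = (\<Sum>y\<in>reps m. h y (expo m y))"
  proof -
    have "inj_on fst (set (table m))" using d by (simp add: distinct_map)
    moreover have "expo m y = r" if "(y, r) \<in> set (table m)" for y r
      using d that by (simp add: expo_def)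
    ultimately show ?thesis
      unfolding reps_def by (auto simp: sum.reindex intro!: sum.cong)
  qed
  finally show ?thesis ..
qed

lemma card_reps:
  assumes "valid_table m"
  shows "finite (reps m)" "card (reps m) = 8 ^ (m - 1)"
proof -
  have "card (set (map fst (table m))) = 8 ^ (m - 1)"
    using assms distinct_card[of "map fst (table m)"] by (simp only: valid_table_def length_map)
  thus "finite (reps m)" "card (reps m) = 8 ^ (m - 1)" by (simp_all add: reps_def)
qed

lemma reps_bounds:
  assumes "valid_table m" "(a, b, c) \<in> reps m"
  shows "a \<in> {0..<2 ^ (m - 1)}" "b \<in> {0..<2 ^ (m - 1)}" "c \<in> {0..<2 ^ (m - 1)}"
proof -
  obtain p where p: "p \<in> set (table m)" "fst p = (a, b, c)"
    using assms(2) by (metis imageE reps_def)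
  have "fst (fst p) \<in> {0..<2 ^ (m - 1)} \<and> fst (snd (fst p)) \<in> {0..<2 ^ (m - 1)} \<and>
      snd (snd (fst p)) \<in> {0..<2 ^ (m - 1)}"
    using assms(1) p(1) unfolding valid_table_def by blast
  thus "a \<in> {0..<2 ^ (m - 1)}" "b \<in> {0..<2 ^ (m - 1)}" "c \<in> {0..<2 ^ (m - 1)}"
    using p(2) by simp_all
qed

lemma table_exponents: "valid_table m \<Longrightarrow> p \<in> set (table m) \<Longrightarrow> snd p \<in> {0, 1, 2}"
  unfolding valid_table_def by blast

text \<open>Eisenstein integers in the basis 1, \<omega>, so that Fourier coefficients can be
  evaluated exactly with integers.\<close>

definition eis :: "int \<times> int \<Rightarrow> complex" where
  "eis z = of_int (fst z) + of_int (snd z) * \<omega>"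

lemma omega_square: "\<omega>\<^sup>2 = - 1 - \<omega>"
proof -
  have "\<omega> + cnj \<omega> = - 1"
    using cube_root_unity_cases[OF omega_cube] omega_neq_1 by simp
  thus ?thesis using cube_root_unity_cnj(2)[OF omega_cube] by (simp add: algebra_simps)
qed

fun rot :: "int \<times> int \<Rightarrow> int \<times> int" where
  "rot (p, q) = (- q, p - q)"

lemma eis_rot: "eis (rot z) = \<omega> * eis z"
proof (cases z)
  case (Pair p q)
  have "\<omega> * eis z = of_int p * \<omega> + of_int q * \<omega>\<^sup>2"
    by (simp add: Pair eis_def power2_eq_square algebra_simps)
  thus ?thesis by (simp add: Pair eis_def omega_square algebra_simps)
qed

text \<open>The last branch stands for r = 2, where \<omega>^2 = -1 - \<omega>.\<close>

fun add_mult_root :: "nat \<Rightarrow> int \<Rightarrow> int \<times> int \<Rightarrow> int \<times> int" where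
  "add_mult_root r t (p, q) =
     (if t = 0 then (p, q) else if r = 0 then (p + t, q) else if r = 1 then (p, q + t) else (p - t, q - t))"

lemma eis_add_mult_root:
  assumes "r \<in> {0, 1, 2}"
  shows "eis (add_mult_root r t z) = eis z + \<omega> ^ r * of_int t"
  using assms by (cases z) (auto simp: eis_def omega_square algebra_simps)

text \<open>An accumulating sum; with n = 2^(m-1) the inner conditional is the Ramanujan sum of
  modulus 2n.\<close>

fun table_sum :: "int \<Rightarrow> ((int \<times> int \<times> int) \<times> nat) list \<Rightarrow> quad \<Rightarrow> int \<times> int \<Rightarrow> int \<times> int" where
  "table_sum n [] x z = z"
| "table_sum n (((a, b, c), r) # l) (x0, x1, x2, x3) z =
     table_sum n l (x0, x1, x2, x3)
       (let s = x0 + 2 * (a * x1 + b * x2 + c * x3)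
        in add_mult_root r (if (2 * n) dvd s then n else if n dvd s then - n else 0) z)"

lemma eis_table_sum:
  assumes "\<And>p. p \<in> set l \<Longrightarrow> snd p \<in> {0, 1, 2}" "m \<ge> 1"
  shows "eis (table_sum (2 ^ (m - 1)) l x z) =
    eis z + (\<Sum>(y, r)\<leftarrow>l. \<omega> ^ r * of_int (ramanujan m (dot x (base y))))"
  using assms
proof (induction l arbitrary: z)
  case (Cons p l)
  obtain a b c r where p: "p = ((a, b, c), r)" by (metis prod.exhaust)
  obtain x0 x1 x2 x3 where x: "x = (x0, x1, x2, x3)" by (metis prod.exhaust)
  have "r \<in> {0, 1, 2}" using Cons.prems(1)[of p] p by simp
  have r: "ramanujan m (dot x (base (a, b, c))) = (let s = x0 + 2 * (a * x1 + b * x2 + c * x3)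
      in if (2 * 2 ^ (m - 1)) dvd s then 2 ^ (m - 1) else if 2 ^ (m - 1) dvd s then - (2 ^ (m - 1)) else 0)"
    using \<open>m \<ge> 1\<close> by (simp add: ramanujan_def x Let_def algebra_simps flip: power_Suc)
  have "table_sum (2 ^ (m - 1)) (p # l) x z =
      table_sum (2 ^ (m - 1)) l x (add_mult_root r (ramanujan m (dot x (base (a, b, c)))) z)"
    unfolding r by (simp add: p x Let_def)
  thus ?case
    using Cons eis_add_mult_root[OF \<open>r \<in> {0, 1, 2}\<close>] by (simp add: p)
qed simp

text \<open>For odd first entry all summands vanish, which more than halves the work below.\<close>

definition layer :: "nat \<Rightarrow> quad \<Rightarrow> int \<times> int" where
  "layer m x = (if m > 1 \<and> odd (fst x) then (0, 0) else table_sum (2 ^ (m - 1)) (table m) x (0, 0))"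

lemma eis_layer:
  assumes m: "m \<in> {1, 2, 3}"
  shows "eis (layer m x) = (\<Sum>y\<in>reps m. \<omega> ^ expo m y * of_int (ramanujan m (dot x (base y))))"
proof (cases "m > 1 \<and> odd (fst x)")
  case True
  \<comment> \<open>Modulo 2 every base point is (1, 0, 0, 0), so the dot product is odd, and for m
    > 1 the Ramanujan sum of an odd number is 0.\<close>
  have "ramanujan m (dot x (base y)) = 0" for y
  proof -
    obtain x0 x1 x2 x3 where x: "x = (x0, x1, x2, x3)" by (metis prod.exhaust)
    obtain a b c where y: "y = (a, b, c)" by (metis prod.exhaust)
    have "odd (dot x (base y))" using True by (simp add: x y)
    hence "\<not> 2 ^ n dvd dot x (base y)" if "n > 0" for n
      using that by (metis dvd_power dvd_trans)
    thus ?thesis using True by (simp add: ramanujan_def)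
  qed
  thus ?thesis using True by (simp add: layer_def eis_def)
next
  case False
  note r = table_exponents[OF valid_table[OF m]]
  have "m \<ge> 1" using m by auto
  have "layer m x = table_sum (2 ^ (m - 1)) (table m) x (0, 0)"
    unfolding layer_def using False by (rule if_not_P)
  thus ?thesis
    unfolding sum_table[OF valid_table[OF m], of "\<lambda>y r. \<omega> ^ r * of_int (ramanujan m (dot x (base y)))"]
    using eis_table_sum[OF r \<open>m \<ge> 1\<close>, where x = x and z = "(0, 0)"] by (simp add: eis_def[of "(0, 0)"])
qed

fun layers :: "nat \<Rightarrow> quad \<Rightarrow> int \<times> int" where
  "layers 0 x = (0, 0)"
| "layers (Suc m) x = (case layer (Suc m) x of (p, q) \<Rightarrow> case layers m x of (p', q') \<Rightarrow> (p + p', q + q'))"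

text \<open>The share in a Fourier coefficient of the points with Teichmueller exponent 0, after
  summation over the integer units; \<open>m\<close> is \<open>k\<close> minus the 2-adic
  level.\<close>

definition coeff_sum :: "nat \<Rightarrow> quad \<Rightarrow> complex" where
  "coeff_sum k x = (\<Sum>m\<in>{1..k}. \<Sum>y\<in>reps m. \<omega> ^ expo m y * of_int (ramanujan m (dot x (base y))))"

lemma eis_layers: "k \<le> 3 \<Longrightarrow> eis (layers k x) = coeff_sum k x"
proof (induction k)
  case (Suc k)
  have "Suc k \<in> {1, 2, 3}" using Suc.prems by auto
  have "eis (layers (Suc k) x) = eis (layer (Suc k) x) + eis (layers k x)"
    by (simp add: eis_def algebra_simps split: prod.split)
  thus ?case using Suc eis_layer[OF \<open>Suc k \<in> {1, 2, 3}\<close>] by (simp add: coeff_sum_def)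
qed (simp add: coeff_sum_def eis_def)

lemma coeff_sum_cong:
  assumes "k \<le> 3" "qdvd 8 (x - x')"
  shows "coeff_sum k x = coeff_sum k x'"
proof -
  have "ramanujan m (dot x (base y)) = ramanujan m (dot x' (base y))" if "m \<in> {1..k}" for m y
  proof (rule ramanujan_cong)
    have "2 ^ m dvd (8 :: int)" using le_imp_power_dvd[of m 3 "2 :: int"] that assms(1) by simp
    moreover have "8 dvd dot x (base y) - dot x' (base y)"
      using dvd_dot[OF assms(2), of "base y"] by (simp add: dot_diff dot_commute)
    ultimately show "2 ^ m dvd dot x (base y) - dot x' (base y)"
      by (rule dvd_trans)
  qed
  thus ?thesis by (simp add: coeff_sum_def)
qed

text \<open>Reducing modulo 8 keeps the numbers small in the evaluation below.\<close>

fun step :: "quad \<Rightarrow> quad" where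
  "step (a, b, c, d) = ((3 * a - c) mod 8, (- b - d) mod 8, (- a - 3 * c - d) mod 8, (- b - c - 2 * d) mod 8)"

text \<open>Horner scheme in \<omega> for the sum over the Teichmueller exponents.\<close>

fun transform :: "nat \<Rightarrow> nat \<Rightarrow> quad \<Rightarrow> int \<times> int" where
  "transform k 0 x = (0, 0)"
| "transform k (Suc n) x = (case layers k x of (p, q) \<Rightarrow>
     case rot (transform k n (step x)) of (p', q') \<Rightarrow> (p + p', q + q'))"

lemma qdvd_step: "qdvd 8 (step x - turn x)"
proof -
  have "n dvd a mod n - a" for a n :: int by (simp add: mod_eq_dvd_iff[symmetric])
  thus ?thesis by (cases x) simp
qed

lemma eis_transform:
  assumes "k \<le> 3"
  shows "eis (transform k n x) = (\<Sum>i<n. \<omega> ^ i * coeff_sum k ((turn ^^ i) x))"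
proof (induction n arbitrary: x)
  case (Suc n)
  have *: "coeff_sum k ((turn ^^ i) (step x)) = coeff_sum k ((turn ^^ i) (turn x))" for i
    using qdvd_turn_pow[OF qdvd_step] by (intro coeff_sum_cong[OF assms]) (simp add: turn_pow_diff)
  have "eis (transform k (Suc n) x) = eis (layers k x) + eis (rot (transform k n (step x)))"
    by (simp add: eis_def algebra_simps split: prod.split)
  also have "\<dots> = coeff_sum k x + \<omega> * (\<Sum>i<n. \<omega> ^ i * coeff_sum k ((turn ^^ i) (turn x)))"
    by (simp add: eis_rot Suc.IH eis_layers assms *)
  also have "\<dots> = (\<Sum>i<Suc n. \<omega> ^ i * coeff_sum k ((turn ^^ i) x))"
    by (subst sum.lessThan_Suc_shift) (simp add: sum_distrib_left funpow_swap1 mult.assoc)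
  finally show ?case .
qed (simp add: eis_def)

text \<open>The three pairs are n, n \<omega> and n \<omega>^2 for n = -(4^k).\<close>

definition cube_transform_at :: "nat \<Rightarrow> quad \<Rightarrow> bool" where
  "cube_transform_at k x \<longleftrightarrow> transform k 15 x \<in> {(- (4 ^ k), 0), (0, - (4 ^ k)), (4 ^ k, 4 ^ k)}"

lemma cube_transform:
  assumes "cube_transform_at k x" "k \<le> 3"
  shows "(\<Sum>i<15. \<omega> ^ i * coeff_sum k ((turn ^^ i) x)) ^ 3 = (- (4 ^ k)) ^ 3"
proof -
  have "eis (transform k 15 x) \<in> {- (4 ^ k), - (4 ^ k) * \<omega>, - (4 ^ k) * \<omega>\<^sup>2}"
    using assms(1) unfolding cube_transform_at_def by (auto simp: eis_def omega_square algebra_simps)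
  hence "eis (transform k 15 x) ^ 3 = (- (4 ^ k)) ^ 3"
    using omega_cube omega_power_cube[of 2] by (auto simp: power_mult_distrib)
  thus ?thesis by (simp add: eis_transform[OF assms(2)])
qed

text \<open>One frequency from each orbit of the nonzero vectors under \<open>turn\<close> and the
  odd integers; quantifying over lists makes the test executable.\<close>

definition all_cube_transforms :: "nat \<Rightarrow> bool" where
  "all_cube_transforms k \<longleftrightarrow> (\<forall>j \<in> set [0..<k]. \<forall>p \<in> set (table (k - j)). cube_transform_at k (scale (2 ^ j) (base (fst p))))"

section \<open>Cubic functions on powers of cyclic groups of order 4 and 8\<close>

fun parity :: "quad \<Rightarrow> bool \<times> bool \<times> bool \<times> bool" where
  "parity (a, b, c, d) = (odd a, odd b, odd c, odd d)"

fun parity_turn :: "bool \<times> bool \<times> bool \<times> bool \<Rightarrow> bool \<times> bool \<times> bool \<times> bool" where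
  "parity_turn (a, b, c, d) = (a \<noteq> c, b \<noteq> d, (a \<noteq> c) \<noteq> d, b \<noteq> c)"

lemma parity_turn_pow: "parity ((turn ^^ i) x) = (parity_turn ^^ i) (parity x)"
proof (induction i)
  case (Suc i)
  have "parity (turn x) = parity_turn (parity x)" for x by (cases x) auto
  thus ?case using Suc by simp
qed simp

text \<open>Modulo 2 all base points coincide, and \<open>turn\<close> moves that vector through 15
  different ones; hence the residue modulo 2 determines the exponent.\<close>

lemma parity_orbit:
  assumes "i < 15" "i' < 15" "qdvd 2 ((turn ^^ i) (base y) - (turn ^^ i') (base y'))"
  shows "i = i'"
proof -
  have b: "parity (base y) = (True, False, False, False)" for y
    by (cases y) simp
  have "parity x = parity x'" if "qdvd 2 (x - x')" for x x' :: quad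
    using that by (cases x; cases x') auto
  from this[OF assms(3)] have "(parity_turn ^^ i) (True, False, False, False) = (parity_turn ^^ i') (True, False, False, False)"
    by (simp only: parity_turn_pow b)
  moreover have "distinct (map (\<lambda>i. (parity_turn ^^ i) (True, False, False, False)) [0..<15])"
    by code_simp
  ultimately show ?thesis using assms(1,2)
    by (simp add: distinct_map inj_on_def)
qed

lemma not_qdvd_2_orbit: "\<not> qdvd 2 ((turn ^^ i) (base y))"
proof
  assume "qdvd 2 ((turn ^^ i) (base y))"
  hence "qdvd 2 ((turn ^^ j) ((turn ^^ i) (base y)))" for j by (rule qdvd_turn_pow)
  hence *: "qdvd 2 ((turn ^^ (j + i)) (base y))" for j by (simp add: funpow_add)
  \<comment> \<open>Another 14i turns complete the exponent to a multiple of 15, which leads back to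
    the base point modulo 8 and contradicts its odd first entry.\<close>
  have "15 * i = 14 * i + i" by simp
  hence "qdvd 2 ((turn ^^ (15 * i)) (base y))" using *[of "14 * i"] by (simp only: )
  moreover have "qdvd 8 ((turn ^^ (15 * i)) x - x)" for x
  proof (induction i)
    case 0
    thus ?case by (simp add: zero_prod_def)
  next
    case (Suc i)
    have "(turn ^^ (15 * Suc i)) x - x = ((turn ^^ (15 * i + 15)) x - (turn ^^ (15 * i)) x) + ((turn ^^ (15 * i)) x - x)"
      by (simp add: add.commute)
    thus ?case using qdvd_add[OF turn_pow_add_15 Suc.IH] by (simp only: )
  qed
  hence "qdvd 2 ((turn ^^ (15 * i)) (base y) - base y)" by (rule qdvd_trans[rotated]) simp
  ultimately have "qdvd 2 ((turn ^^ (15 * i)) (base y) - ((turn ^^ (15 * i)) (base y) - base y))"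
    by (rule qdvd_diff)
  thus False by (cases y) simp
qed

lemma sum_powers_omega: "(\<Sum>i<15. \<omega> ^ i) = 0"
proof -
  have "\<omega> ^ 15 = (\<omega> ^ 3) ^ 5" by (simp flip: power_mult)
  thus ?thesis using geometric_sum[OF omega_neq_1, of 15] by (simp add: omega_cube)
qed

lemma sum_shift_periodic:
  fixes h :: "nat \<Rightarrow> 'a::cancel_comm_monoid_add"
  assumes "\<And>i. h (i + n) = h i"
  shows "(\<Sum>i<n. h (i + s)) = (\<Sum>i<n. h i)"
proof (induction s)
  case (Suc s)
  have "(\<Sum>i<n. h (i + Suc s)) + h s = (\<Sum>i<Suc n. h (i + s))"
    by (subst sum.lessThan_Suc_shift) (simp add: add.commute)
  also have "\<dots> = (\<Sum>i<n. h (i + s)) + h s" using assms[of s] by (simp add: add.commute)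
  finally show ?case using Suc by simp
qed simp

lemma finite_odds [simp]: "finite (odds m)"
  by (rule finite_subset[of _ "{0..<2 ^ m}"]) (auto simp: odds_def)

lemma card_odds: "m \<ge> 1 \<Longrightarrow> card (odds m) = 2 ^ (m - 1)"
proof -
  assume "m \<ge> 1"
  \<comment> \<open>The Ramanujan sum at 0 counts the odd residues.\<close>
  have "of_nat (card (odds m)) = (\<Sum>w\<in>odds m. dyadic_root m (w * 0))" by simp
  also have "\<dots> = of_nat (2 ^ (m - 1))"
    unfolding sum_dyadic_root_odds[OF \<open>m \<ge> 1\<close>] by (simp add: ramanujan_def)
  finally show ?thesis by (simp only: of_nat_eq_iff)
qed

lemma sum_SIGMA_nested:
  assumes "finite J" "finite A" "\<And>j. j \<in> J \<Longrightarrow> finite (B j)" "\<And>j. j \<in> J \<Longrightarrow> finite (C j)"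
  shows "(\<Sum>p\<in>(SIGMA j:J. A \<times> B j \<times> C j). f p) = (\<Sum>j\<in>J. \<Sum>i\<in>A. \<Sum>w\<in>B j. \<Sum>y\<in>C j. f (j, i, w, y))"
proof -
  have "(\<Sum>j\<in>J. \<Sum>i\<in>A. \<Sum>w\<in>B j. \<Sum>y\<in>C j. f (j, i, w, y)) = (\<Sum>j\<in>J. \<Sum>q\<in>A \<times> B j \<times> C j. f (j, q))"
    by (simp add: sum.cartesian_product split_def)
  also have "\<dots> = (\<Sum>p\<in>(SIGMA j:J. A \<times> B j \<times> C j). f p)"
    using assms by (subst sum.Sigma) (auto simp: split_def)
  finally show ?thesis ..
qed

text \<open>\<open>\<pi>\<close> is reduction modulo 2^k on integer quadruples, given by its kernel;
  it is onto by counting. This treats the moduli 4 and 8 together.\<close>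

locale dyadic_quads =
  fixes k :: nat and \<pi> :: "quad \<Rightarrow> 'g::{ab_group_add,finite}"
  assumes k: "k \<in> {2, 3}"
    and pi_diff: "\<pi> (x - y) = \<pi> x - \<pi> y"
    and pi_eq_0: "\<pi> x = 0 \<longleftrightarrow> qdvd (2 ^ k) x"
    and card_group: "CARD('g) = 16 ^ k"
    and all_cube_transforms: "all_cube_transforms k"
begin

section \<open>Coordinates on the nonzero elements\<close>

definition params :: "(nat \<times> nat \<times> int \<times> (int \<times> int \<times> int)) set" where
  "params = (SIGMA j:{..<k}. {..<15} \<times> odds (k - j) \<times> reps (k - j))"

text \<open>Coordinates $(j, i, w, y)$: the 2-adic level, the exponent of the Teichmueller unit, the integer
  unit, and the principal unit $(1, 2a, 2b, 2c)$.\<close>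

fun point :: "nat \<times> nat \<times> int \<times> (int \<times> int \<times> int) \<Rightarrow> quad" where
  "point (j, i, w, y) = scale (2 ^ j * w) ((turn ^^ i) (base y))"

fun weight :: "nat \<times> nat \<times> int \<times> (int \<times> int \<times> int) \<Rightarrow> complex" where
  "weight (j, i, w, y) = \<omega> ^ (i + expo (k - j) y)"

lemma k_bounds: "k \<le> 3" "k > 0"
  using k by auto

lemma table_index: "j < k \<Longrightarrow> k - j \<in> {1, 2, 3}"
  using k by auto

lemma valid: "j < k \<Longrightarrow> valid_table (k - j)"
  using table_index valid_table by blast

lemma pi_eq_iff: "\<pi> x = \<pi> y \<longleftrightarrow> qdvd (2 ^ k) (x - y)"
  using pi_eq_0[of "x - y"] by (simp add: pi_diff)

lemma pi_0: "\<pi> 0 = 0"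
  using pi_diff[of 0 0] by simp

lemma pi_add: "\<pi> (x + y) = \<pi> x + \<pi> y"
  using pi_diff[of x "0 - y"] pi_diff[of 0 y] by (simp add: pi_0)

text \<open>Level \<open>j\<close> carries 15 * 2^(m-1) * 8^(m-1) = 15 * 16^(m-1) tuples with m = k
  - j, a geometric sum.\<close>

lemma card_params: "card params + 1 = 16 ^ k"
proof -
  have "card params = (\<Sum>j<k. 15 * (2 ^ (k - j - 1) * 8 ^ (k - j - 1)))"
    unfolding params_def using card_reps valid card_odds
    by (subst card_SigmaI) (auto simp: card_cartesian_product intro!: sum.cong)
  also have "\<dots> = (\<Sum>j<k. 15 * 16 ^ (k - Suc j))"
    by (simp flip: power_mult_distrib)
  also have "\<dots> = (\<Sum>j<k. 15 * 16 ^ j)" by (rule sum.nat_diff_reindex)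
  also have "\<dots> + 1 = 16 ^ k" by (induction k) simp_all
  finally show ?thesis by simp
qed

text \<open>If j < j', reduction modulo 2^(j+1) removes the second point, so 2 would divide an odd
  multiple of a turned base point. Equality of levels follows by exchanging the points.\<close>

lemma level_le:
  assumes "(j, i, w, y) \<in> params" "(j', i', w', y') \<in> params"
    and "\<pi> (point (j, i, w, y)) = \<pi> (point (j', i', w', y'))"
  shows "j' \<le> j"
proof (rule ccontr)
  assume "\<not> j' \<le> j"
  define v where "v = scale w ((turn ^^ i) (base y))"
  define v' where "v' = scale w' ((turn ^^ i') (base y'))"
  have j: "Suc j \<le> j'" "Suc j \<le> k" "odd w" 
    using \<open>\<not> j' \<le> j\<close> assms(1) by (auto simp: params_def odds_def)
  have scale_mult: "scale (s * t) x = scale s (scale t x)" for s t x by (cases x) (simp add: mult.assoc)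
  have dvd_scale: "n dvd s \<Longrightarrow> qdvd n (scale s x)" for n s x by (cases x) simp
  have "qdvd (2 ^ k) (scale (2 ^ j) v - scale (2 ^ j') v')"
    using assms(3) by (simp add: pi_eq_iff v_def v'_def scale_mult)
  hence "qdvd (2 ^ Suc j) (scale (2 ^ j) v - scale (2 ^ j') v')"
    by (rule qdvd_trans[rotated]) (use j in \<open>intro le_imp_power_dvd\<close>)
  moreover have "qdvd (2 ^ Suc j) (scale (2 ^ j') v')"
    using j by (intro dvd_scale le_imp_power_dvd)
  ultimately have "qdvd (2 ^ Suc j) (scale (2 ^ j) v)"
    using qdvd_add by (metis diff_add_cancel)
  hence "qdvd (2 ^ j * 2) (scale (2 ^ j) v)" by (simp add: mult.commute)
  hence "qdvd 2 v" by (subst (asm) qdvd_scale_cancel) auto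
  hence "qdvd 2 ((turn ^^ i) (base y))"
    using \<open>odd w\<close> by (cases "(turn ^^ i) (base y)") (simp add: v_def)
  thus False using not_qdvd_2_orbit by blast
qed

text \<open>The coordinates are recovered in turn: the level, the exponent \<open>i\<close> from
  parities, and, once the turns are undone, \<open>w\<close> from the first entry and a, b, c from
  the others.\<close>

lemma inj_on_params: "inj_on (\<lambda>p. \<pi> (point p)) params"
proof (rule inj_onI)
  fix p p' assume *: "p \<in> params" "p' \<in> params" "\<pi> (point p) = \<pi> (point p')"
  obtain j i w a b c where p: "p = (j, i, w, a, b, c)" by (metis prod.exhaust)
  obtain j' i' w' a' b' c' where p': "p' = (j', i', w', a', b', c')" by (metis prod.exhaust)
  define m where "m = k - j"
  have "j' = j" using level_le * unfolding p p' by (metis le_antisym)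
  have mem: "j < k" "i < 15" "i' < 15" "w \<in> odds m" "w' \<in> odds m" "(a, b, c) \<in> reps m" "(a', b', c') \<in> reps m"
    using *(1,2) \<open>j' = j\<close> by (auto simp: params_def p p' m_def)
  have w: "odd w" "odd w'" using mem by (auto simp: odds_def)
  have m: "1 \<le> m" "m \<le> 3" and km: "2 ^ k = (2 :: int) ^ j * 2 ^ m"
    using mem(1) k_bounds by (simp_all add: m_def flip: power_add)
  have "point p - point p' = scale (2 ^ j) (scale w ((turn ^^ i) (base (a, b, c))) - scale w' ((turn ^^ i') (base (a', b', c'))))"
    unfolding p p' \<open>j' = j\<close>
    by (cases "(turn ^^ i) (base (a, b, c))"; cases "(turn ^^ i') (base (a', b', c'))") (simp add: algebra_simps)
  hence d: "qdvd (2 ^ m) (scale w ((turn ^^ i) (base (a, b, c))) - scale w' ((turn ^^ i') (base (a', b', c'))))"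
    using *(3) by (simp add: pi_eq_iff km qdvd_scale_cancel)
  have "qdvd 2 (scale w ((turn ^^ i) (base (a, b, c))) - scale w' ((turn ^^ i') (base (a', b', c'))))"
    using d by (rule qdvd_trans[rotated]) (use m in simp)
  hence "qdvd 2 ((turn ^^ i) (base (a, b, c)) - (turn ^^ i') (base (a', b', c')))"
    using w by (cases "(turn ^^ i) (base (a, b, c))"; cases "(turn ^^ i') (base (a', b', c'))") simp
  hence "i' = i" using parity_orbit mem by blast
  define z where "z = scale w (base (a, b, c)) - scale w' (base (a', b', c'))"
  have "qdvd (2 ^ m) ((turn ^^ i) z)"
    using d unfolding \<open>i' = i\<close> z_def by (simp only: turn_pow_diff turn_pow_scale)
  \<comment> \<open>Turning 15 - i more times undoes the i turns modulo 8, hence modulo 2^m.\<close>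
  hence "qdvd (2 ^ m) ((turn ^^ (15 - i)) ((turn ^^ i) z))"
    by (rule qdvd_turn_pow)
  also have "(turn ^^ (15 - i)) ((turn ^^ i) z) = (turn ^^ (15 - i + i)) z"
    by (simp only: funpow_add o_apply)
  also have "15 - i + i = 15" using mem(2) by simp
  finally have z15: "qdvd (2 ^ m) ((turn ^^ 15) z)" .
  have "2 ^ m dvd (8 :: int)" using le_imp_power_dvd[of m 3 "2 :: int"] m by simp
  hence "qdvd (2 ^ m) ((turn ^^ 15) z - ((turn ^^ 15) z - z))"
    by (intro qdvd_diff z15 qdvd_trans[OF _ turn_pow_15])
  hence "qdvd (2 ^ m) z" by (simp only: diff_diff_eq2 add_diff_cancel_left')
  hence e: "2 ^ m dvd w - w'" "2 ^ m dvd 2 * (w * a - w' * a')" "2 ^ m dvd 2 * (w * b - w' * b')"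
      "2 ^ m dvd 2 * (w * c - w' * c')"
    by (simp_all add: z_def algebra_simps)
  have small: "x = x'" if "n dvd x - x'" "0 \<le> x" "x < n" "0 \<le> x'" "x' < n" for x x' n :: int
    using that by (metis mod_eq_dvd_iff mod_pos_pos_trivial)
  have "w = w'" using e(1) mem(4,5) by (intro small[of "2 ^ m"]) (auto simp: odds_def)
  \<comment> \<open>The factor 2 in \<open>base\<close> costs one binary digit; so a, b, c are
    determined modulo 2^(m-1), exactly the range of the table.\<close>
  have half: "x = x'" if "2 ^ m dvd 2 * (w * x - w' * x')" "x \<in> {0..<2 ^ (m - 1)}" "x' \<in> {0..<2 ^ (m - 1)}" for x x'
  proof -
    have "(2 :: int) * 2 ^ (m - 1) dvd 2 * (w * (x - x'))"
      using that(1) m \<open>w = w'\<close> by (simp add: algebra_simps flip: power_Suc)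
    hence "2 ^ (m - 1) dvd w * (x - x')" by (subst (asm) dvd_mult_cancel_left) auto
    moreover have "coprime (2 ^ (m - 1)) w" using w by simp
    ultimately have "2 ^ (m - 1) dvd x - x'" by (simp only: coprime_dvd_mult_right_iff)
    thus ?thesis using that by (intro small[of "2 ^ (m - 1)"]) auto
  qed
  have v: "valid_table m" using valid[OF mem(1)] by (simp add: m_def)
  have "a = a'" "b = b'" "c = c'"
    using half e reps_bounds[OF v] mem(6,7) by meson+
  thus "p = p'" by (simp add: p p' \<open>j' = j\<close> \<open>i' = i\<close> \<open>w = w'\<close>)
qed

lemma pi_point_neq_0: "p \<in> params \<Longrightarrow> \<pi> (point p) \<noteq> 0"
proof
  assume *: "p \<in> params" "\<pi> (point p) = 0"
  obtain j i w y where p: "p = (j, i, w, y)" by (metis prod.exhaust)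
  have "j < k" "odd w" using *(1) by (auto simp: p params_def odds_def)
  have "2 ^ k = (2 :: int) ^ j * 2 ^ (k - j)" using \<open>j < k\<close> by (simp flip: power_add)
  moreover have "point p = scale (2 ^ j) (scale w ((turn ^^ i) (base y)))"
    by (cases "(turn ^^ i) (base y)") (simp add: p)
  ultimately have "qdvd (2 ^ (k - j)) (scale w ((turn ^^ i) (base y)))"
    using *(2) by (simp add: pi_eq_0 qdvd_scale_cancel del: point.simps)
  hence "qdvd 2 (scale w ((turn ^^ i) (base y)))" by (rule qdvd_trans[rotated]) (use \<open>j < k\<close> in simp)
  hence "qdvd 2 ((turn ^^ i) (base y))" using \<open>odd w\<close> by (cases "(turn ^^ i) (base y)") simp
  thus False using not_qdvd_2_orbit by blast
qed

lemma bij_params: "bij_betw (\<lambda>p. \<pi> (point p)) params (- {0})"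
proof -
  have "card ((\<lambda>p. \<pi> (point p)) ` params) = card (- {0 :: 'g})"
    using card_image[OF inj_on_params] card_params card_group by (simp add: card_Diff_singleton Compl_eq_Diff_UNIV)
  hence "(\<lambda>p. \<pi> (point p)) ` params = - {0}"
    using pi_point_neq_0 by (intro card_subset_eq) auto
  thus ?thesis using inj_on_params by (simp add: bij_betw_def)
qed

lemma surj_pi: "surj \<pi>"
proof -
  have "g \<in> range \<pi>" for g
  proof (cases "g = 0")
    case False
    hence "g \<in> (\<lambda>p. \<pi> (point p)) ` params" using bij_params by (simp add: bij_betw_def)
    thus ?thesis by blast
  qed (use pi_0 in \<open>metis rangeI\<close>)
  thus ?thesis by blast
qed

definition pairing :: "'g \<Rightarrow> 'g \<Rightarrow> complex" where
  "pairing g h = dyadic_root k (dot (inv \<pi> g) (inv \<pi> h))"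

section \<open>Self-duality of the group\<close>

lemma pairing_pi: "pairing (\<pi> u) (\<pi> v) = dyadic_root k (dot u v)"
proof -
  have *: "qdvd (2 ^ k) (inv \<pi> (\<pi> x) - x)" for x
    using surj_f_inv_f[OF surj_pi] by (simp flip: pi_eq_iff)
  have "dot (inv \<pi> (\<pi> u)) (inv \<pi> (\<pi> v)) - dot u v =
      dot (inv \<pi> (\<pi> u)) (inv \<pi> (\<pi> v) - v) + dot v (inv \<pi> (\<pi> u) - u)"
    by (simp add: dot_diff dot_commute)
  moreover have "2 ^ k dvd \<dots>" using * by (intro dvd_add dvd_dot)
  ultimately show ?thesis unfolding pairing_def by (intro dyadic_root_cong) (simp only:)
qed

lemma cases_pi: obtains u where "g = \<pi> u"
  using surj_pi by (metis surj_f_inv_f)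

sublocale self_dual_group pairing
proof
  fix u x y :: 'g
  obtain u' x' y' where "u = \<pi> u'" "x = \<pi> x'" "y = \<pi> y'" using cases_pi by metis
  thus "pairing u (x + y) = pairing u x * pairing u y" "pairing u x = pairing x u"
    by (simp_all add: pairing_pi dot_add dyadic_root_add dot_commute flip: pi_add)
  show "norm (pairing u x) = 1" by (simp add: pairing_def)
next
  fix x :: 'g assume "x \<noteq> 0"
  obtain v where x: "x = \<pi> v" using cases_pi by metis
  obtain a b c d where v: "v = (a, b, c, d)" by (metis prod.exhaust)
  show "\<exists>u. pairing u x \<noteq> 1"
  proof (rule ccontr)
    assume "\<nexists>u. pairing u x \<noteq> 1"
    hence "2 ^ k dvd dot u v" for u
      using pairing_pi[of u v] by (simp add: x dyadic_root_eq_1_iff)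
    \<comment> \<open>The unit vectors read off the coordinates of \<open>v\<close>.\<close>
    from this[of "(1, 0, 0, 0)"] this[of "(0, 1, 0, 0)"] this[of "(0, 0, 1, 0)"] this[of "(0, 0, 0, 1)"]
    show False using \<open>x \<noteq> 0\<close> by (simp add: x pi_eq_0 v)
  qed
qed

section \<open>The cubic function and its Fourier coefficients\<close>

definition cubic :: "'g \<Rightarrow> complex" where
  "cubic g = (if g = 0 then 0 else weight (inv_into params (\<lambda>p. \<pi> (point p)) g))"

lemma cubic_point: "p \<in> params \<Longrightarrow> cubic (\<pi> (point p)) = weight p"
  using inv_into_f_f[OF inj_on_params] pi_point_neq_0 by (simp add: cubic_def)

lemma cubic_0: "cubic 0 = 0"
  by (simp add: cubic_def)

lemma nonzero_cases:
  assumes "g \<noteq> 0"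
  obtains p where "p \<in> params" "g = \<pi> (point p)"
proof -
  have "g \<in> (\<lambda>p. \<pi> (point p)) ` params" using assms bij_params by (simp add: bij_betw_def)
  thus ?thesis using that by blast
qed

lemma cubic_cube: "g \<noteq> 0 \<Longrightarrow> cubic g ^ 3 = 1"
proof -
  assume "g \<noteq> 0"
  then obtain p where "p \<in> params" "g = \<pi> (point p)" by (rule nonzero_cases)
  thus ?thesis by (cases p) (simp add: cubic_point omega_power_cube del: point.simps)
qed

lemma cubic_minus: "cubic (- g) = cubic g"
proof (cases "g = 0")
  case False
  then obtain p where p: "p \<in> params" "g = \<pi> (point p)" by (rule nonzero_cases)
  obtain j i w y where p': "p = (j, i, w, y)" by (metis prod.exhaust)
  \<comment> \<open>Replacing the unit \<open>w\<close> by its negative modulo 2^(k-j) negates the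
    point, and the weight ignores \<open>w\<close>.\<close>
  define q where "q = (j, i, 2 ^ (k - j) - w, y)"
  have "j < k" using p by (simp add: p' params_def)
  hence "q \<in> params" using p by (auto simp: p' q_def params_def odds_def le_less)
  moreover have "\<pi> (point q) = - g"
  proof -
    have *: "(2 :: int) ^ j * 2 ^ (k - j) = 2 ^ k" using \<open>j < k\<close> by (simp flip: power_add)
    have "point q = scale (2 ^ k) ((turn ^^ i) (base y)) - point p"
      by (cases "(turn ^^ i) (base y)") (simp add: q_def p' algebra_simps flip: *)
    moreover have "\<pi> (scale (2 ^ k) ((turn ^^ i) (base y))) = 0"
      by (cases "(turn ^^ i) (base y)") (simp add: pi_eq_0)
    ultimately show ?thesis by (simp only: pi_diff p(2)) simp
  qed
  ultimately show ?thesis using cubic_point[of p] cubic_point[of q] p by (simp add: p' q_def)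
qed (simp add: cubic_0)

lemma sum_cubic:
  "(\<Sum>g\<in>UNIV. cubic g * h g) = (\<Sum>j<k. \<Sum>i<15. \<Sum>w\<in>odds (k - j). \<Sum>y\<in>reps (k - j).
      weight (j, i, w, y) * h (\<pi> (point (j, i, w, y))))"
proof -
  have "(\<Sum>g\<in>UNIV. cubic g * h g) = (\<Sum>g\<in>- {0}. cubic g * h g)"
    by (rule sum.mono_neutral_right) (auto simp: cubic_0)
  also have "\<dots> = (\<Sum>p\<in>params. cubic (\<pi> (point p)) * h (\<pi> (point p)))"
    by (rule sum.reindex_bij_betw[OF bij_params, symmetric])
  also have "\<dots> = (\<Sum>p\<in>params. weight p * h (\<pi> (point p)))"
    by (intro sum.cong) (simp_all add: cubic_point)
  also have "\<dots> = (\<Sum>j<k. \<Sum>i<15. \<Sum>w\<in>odds (k - j). \<Sum>y\<in>reps (k - j).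
      weight (j, i, w, y) * h (\<pi> (point (j, i, w, y))))"
    unfolding params_def using card_reps valid by (intro sum_SIGMA_nested) auto
  finally show ?thesis .
qed

lemma sum_cubic_eq_0: "sum cubic UNIV = 0"
proof -
  have "sum cubic UNIV = (\<Sum>j<k. \<Sum>i<15. \<Sum>w\<in>odds (k - j). \<Sum>y\<in>reps (k - j). \<omega> ^ i * \<omega> ^ expo (k - j) y)"
    using sum_cubic[of "\<lambda>_. 1"] by (simp add: power_add)
  also have "\<dots> = (\<Sum>j<k. (\<Sum>i<15. \<omega> ^ i) * (\<Sum>w\<in>odds (k - j). \<Sum>y\<in>reps (k - j). \<omega> ^ expo (k - j) y))"
    unfolding sum_distrib_right by (simp only: sum_distrib_left)
  finally show ?thesis by (simp add: sum_powers_omega)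
qed

text \<open>Self-adjointness moves all turns to the frequency, and summing over \<open>w\<close>
  gives Ramanujan sums, which absorb the odd factor \<open>w'\<close>. The factor 2^j lowers the
  modulus from 2^k to 2^(k-j).\<close>

lemma fourier_cubic:
  assumes "(j', i', w', y') \<in> params"
  defines "x \<equiv> scale (2 ^ j') (base y')"
  shows "fourier cubic (\<pi> (point (j', i', w', y'))) = (\<Sum>i<15. \<omega> ^ i * coeff_sum k ((turn ^^ (i + i')) x))"
proof -
  have "odd w'" using assms(1) by (simp add: params_def odds_def)
  have inner: "(\<Sum>w\<in>odds (k - j). pairing (\<pi> (point (j', i', w', y'))) (\<pi> (point (j, i, w, y)))) =
      of_int (ramanujan (k - j) (dot ((turn ^^ (i + i')) x) (base y)))" if "j < k" for i j y
  proof -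
    have "dot (point (j', i', w', y')) (point (j, i, w, y)) = 2 ^ j * (w * (w' * dot ((turn ^^ (i + i')) x) (base y)))" for w
      unfolding funpow_add o_apply
      by (simp add: dot_scale x_def turn_pow_scale dot_turn_pow algebra_simps)
    hence "(\<Sum>w\<in>odds (k - j). pairing (\<pi> (point (j', i', w', y'))) (\<pi> (point (j, i, w, y)))) =
        (\<Sum>w\<in>odds (k - j). dyadic_root (k - j) (w * (w' * dot ((turn ^^ (i + i')) x) (base y))))"
      using that by (simp only: pairing_pi dyadic_root_mult_pow2 less_imp_le)
    thus ?thesis
      using that \<open>odd w'\<close> by (simp add: sum_dyadic_root_odds ramanujan_mult_odd)
  qed
  have "fourier cubic (\<pi> (point (j', i', w', y'))) =
      (\<Sum>j<k. \<Sum>i<15. \<Sum>w\<in>odds (k - j). \<Sum>y\<in>reps (k - j). weight (j, i, w, y) *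
        pairing (\<pi> (point (j', i', w', y'))) (\<pi> (point (j, i, w, y))))"
    unfolding fourier_def sum_cubic ..
  also have "\<dots> = (\<Sum>j<k. \<Sum>i<15. \<Sum>y\<in>reps (k - j). \<omega> ^ i * (\<omega> ^ expo (k - j) y *
      (\<Sum>w\<in>odds (k - j). pairing (\<pi> (point (j', i', w', y'))) (\<pi> (point (j, i, w, y))))))"
    by (subst sum.swap[of _ "reps _"]) (simp add: sum_distrib_left power_add mult.assoc del: point.simps)
  also have "\<dots> = (\<Sum>j<k. \<Sum>i<15. \<Sum>y\<in>reps (k - j). \<omega> ^ i * (\<omega> ^ expo (k - j) y *
      of_int (ramanujan (k - j) (dot ((turn ^^ (i + i')) x) (base y)))))"
    by (intro sum.cong refl) (simp add: inner del: point.simps)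
  also have "\<dots> = (\<Sum>i<15. \<Sum>j<k. \<Sum>y\<in>reps (k - j). \<omega> ^ i * (\<omega> ^ expo (k - j) y *
      of_int (ramanujan (k - j) (dot ((turn ^^ (i + i')) x) (base y)))))"
    by (rule sum.swap)
  also have "\<dots> = (\<Sum>i<15. \<omega> ^ i * coeff_sum k ((turn ^^ (i + i')) x))"
  proof -
    have *: "(\<Sum>j<k. h (k - j)) = (\<Sum>m\<in>{1..k}. h m)" for h :: "nat \<Rightarrow> complex"
      by (rule sum.reindex_bij_witness[of _ "\<lambda>m. k - m" "\<lambda>j. k - j"]) auto
    show ?thesis
      unfolding coeff_sum_def *[symmetric] by (simp only: sum_distrib_left)
  qed
  finally show ?thesis .
qed

text \<open>Shifting the 15-periodic sum by i' multiplies the coefficient by \<omega>^i', which the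
  cube forgets. So the frequencies with i' = 0 and w = 1 suffice.\<close>

lemma fourier_cubic_cube:
  assumes "u \<noteq> 0"
  shows "fourier cubic u ^ 3 = (- (4 ^ k)) ^ 3"
proof -
  obtain p where p: "p \<in> params" "u = \<pi> (point p)" using nonzero_cases[OF assms] .
  obtain j i' w y where p': "p = (j, i', w, y)" by (metis prod.exhaust)
  define x where "x = scale (2 ^ j) (base y)"
  define h where "h = (\<lambda>i. \<omega> ^ i * coeff_sum k ((turn ^^ i) x))"
  have "cube_transform_at k x"
    using all_cube_transforms p(1) unfolding all_cube_transforms_def x_def p' params_def reps_def by auto
  have "h (i + 15) = h i" for i
  proof -
    have "\<omega> ^ (i + 15) = \<omega> ^ i * (\<omega> ^ 3) ^ 5" by (simp flip: power_mult power_add)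
    thus ?thesis
      unfolding h_def using coeff_sum_cong[OF k_bounds(1) turn_pow_add_15[of i x]] by (simp add: omega_cube)
  qed
  hence "(\<Sum>i<15. h (i + i')) = (\<Sum>i<15. h i)" by (rule sum_shift_periodic)
  moreover have "(\<Sum>i<15. h (i + i')) = \<omega> ^ i' * fourier cubic u"
    using fourier_cubic[of j i' w y] p
    by (simp add: p' h_def x_def power_add sum_distrib_left mult_ac del: point.simps)
  ultimately have "(\<omega> ^ i' * fourier cubic u) ^ 3 = (- (4 ^ k)) ^ 3"
    using cube_transform[OF \<open>cube_transform_at k x\<close> k_bounds(1)] by (simp only: h_def)
  thus ?thesis by (simp add: power_mult_distrib omega_power_cube)
qed

theorem cubic_function_cubic: "cubic_function (- (4 ^ k)) cubic"
proof (rule cubic_function_fourier)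
  show "int CARD('g) = (- (4 ^ k))\<^sup>2"
    by (simp add: card_group power2_eq_square flip: power_mult_distrib)
  show "fourier cubic u ^ 3 = of_int (- (4 ^ k)) ^ 3" if "u \<noteq> 0" for u
    using fourier_cubic_cube[OF that] by simp
qed (use cubic_0 cubic_cube cubic_minus sum_cubic_eq_0 in auto)

end

section \<open>The partial difference sets\<close>

lemma all_cube_transforms_2: "all_cube_transforms 2"
  by code_simp

text \<open>Exact evaluation at 64 + 8 + 1 frequencies, one summand per level; for k = 2 there are 8
  + 1.\<close>

lemma all_cube_transforms_3: "all_cube_transforms 3"
  by code_simp

fun quad_vec :: "quad \<Rightarrow> 'r::comm_ring_1 ^ 4" where
  "quad_vec (a, b, c, d) = (\<chi> i. of_int (if i = 1 then a else if i = 2 then b else if i = 3 then c else d))"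

lemma quad_vec_diff: "quad_vec (x - y) = quad_vec x - quad_vec y"
  by (cases x; cases y) (simp add: vec_eq_iff)

lemma quad_vec_eq_0_iff: "(quad_vec x :: 'r::comm_ring_1 ^ 4) = 0 \<longleftrightarrow> qdvd (int CHAR('r)) x"
  by (cases x) (simp add: vec_eq_iff forall_4 of_int_eq_0_iff_char_dvd)

lemma cubic_function_Z4: "\<exists>F :: 4 ^ 4 \<Rightarrow> complex. cubic_function (- 16) F"
proof -
  interpret dyadic_quads 2 "quad_vec :: quad \<Rightarrow> 4 ^ 4"
    by unfold_locales (simp_all add: quad_vec_diff quad_vec_eq_0_iff all_cube_transforms_2)
  show ?thesis using cubic_function_cubic by auto
qed

lemma cubic_function_Z8: "\<exists>F :: 8 ^ 4 \<Rightarrow> complex. cubic_function (- 64) F"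
proof -
  interpret dyadic_quads 3 "quad_vec :: quad \<Rightarrow> 8 ^ 4"
    by unfold_locales (simp_all add: quad_vec_diff quad_vec_eq_0_iff all_cube_transforms_3)
  show ?thesis using cubic_function_cubic by auto
qed

theorem theorem4p1:
  assumes "CARD('f6::{field,finite}) = 2 ^ 6"
    and "CARD('f10::{field,finite}) = 2 ^ 10"
    and "CARD('f14::{field,finite}) = 2 ^ 14"
  shows "(\<exists>D :: ('f6 \<times> (4 ^ 4)) set. neg_latin_square_pds D 16384 5418 1762 1806) \<and>
    (\<exists>D :: ((4 ^ 4) \<times> 'f10) set. neg_latin_square_pds D 262144 87210 28898 29070) \<and>
    (\<exists>D :: ('f10 \<times> (8 ^ 4)) set. neg_latin_square_pds D 4194304 1397418 465122 465806) \<and>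
    (\<exists>D :: ((8 ^ 4) \<times> 'f14) set. neg_latin_square_pds D 67108864 22366890 7452898 7455630)"
proof -
  obtain F4 :: "4 ^ 4 \<Rightarrow> complex" where F4: "cubic_function (- 16) F4"
    using cubic_function_Z4 by blast
  obtain F8 :: "8 ^ 4 \<Rightarrow> complex" where F8: "cubic_function (- 64) F8"
    using cubic_function_Z8 by blast
  \<comment> \<open>The field orders are 2^(2s) with s = 3, 5, 7, all odd.\<close>
  obtain H6 :: "'f6 \<Rightarrow> complex" where H6: "cubic_function 8 H6"
    using binary_field_cubic_function[where 'f = 'f6 and s = 3] assms(1) by auto
  obtain H10 :: "'f10 \<Rightarrow> complex" where H10: "cubic_function 32 H10"
    using binary_field_cubic_function[where 'f = 'f10 and s = 5] assms(2) by auto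
  obtain H14 :: "'f14 \<Rightarrow> complex" where H14: "cubic_function 128 H14"
    using binary_field_cubic_function[where 'f = 'f14 and s = 7] assms(3) by auto
  \<comment> \<open>The witnesses are the square root n of v and r = (n - 2) / 3.\<close>
  have params: "neg_latin_square_params 16384 5418 1762 1806"
    "neg_latin_square_params 262144 87210 28898 29070"
    "neg_latin_square_params 4194304 1397418 465122 465806"
    "neg_latin_square_params 67108864 22366890 7452898 7455630"
    unfolding neg_latin_square_params_def
    by (rule exI[of _ 128], rule exI[of _ 42], simp)
       (rule exI[of _ 512], rule exI[of _ 170], simp,
        rule exI[of _ 2048], rule exI[of _ 682], simp,
        rule exI[of _ 8192], rule exI[of _ 2730], simp)
  \<comment> \<open>Here m = 8, -16, 32, -64 in turn: the second factor is always cubic for -2m, so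
    field and ring alternate as first factor.\<close>
  show ?thesis
    unfolding neg_latin_square_pds_def
    using params product_pds[OF H6, of F4 16384 5418 1762 1806] F4
      product_pds[OF F4, of H10 262144 87210 28898 29070] H10
      product_pds[OF H10, of F8 4194304 1397418 465122 465806] F8
      product_pds[OF F8, of H14 67108864 22366890 7452898 7455630] H14
    by auto
qed

end
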